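(* Let $(T,\Sigma,\mu)$ be a complete $\sigma$-finite measure space, let $Y,Z$ be separable Banach spaces, and let $F:T\times Y\rightrightarrows Z$ be a multifunction with nonempty closed values such that for every $y\in Y$ the multifunction $t\mapsto F(t,y)$ is measurable, and such that there exists $\ell\in L^1(T)$ with $$F(t,y)\subset F(t,z)+\ell(t)\|y-z\|\,\overline{\mathbf B}_Z\qquad\text{for all }t\in T,\ y,z\in Y.$$ If $(x,y)\in L^\infty(T,Y)\times L^1(T,Z)$ satisfies $y(t)\in F(t,x(t))$ for a.e. $t\in T$, then $$\widehat{\mathbf T}_{\mathsf{Sel}_{\infty,1}\{t\mapsto\operatorname{Gr}F(t,\cdot)\}}(x,y)=\mathsf{Sel}_{\infty,1}\big\{t\mapsto\widehat{\mathbf T}_{\operatorname{Gr}F(t,\cdot)}(x(t),y(t))\big\}.$$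
   Context: $L^\infty(T,Y)$, $L^1(T,Z)$ are Lebesgue--Bochner spaces; $Y\times Z$ carries the norm $\|\cdot\|_Y+\|\cdot\|_Z$ and $L^\infty(T,Y)\times L^1(T,Z)$ the norm $\|\cdot\|_{L^\infty}+\|\cdot\|_{L^1}$. $\overline{\mathbf B}_X$ is the closed unit ball of a Banach space $X$. A multifunction $G:T\rightrightarrows W$ with nonempty closed values in a separable Banach space $W$ is measurable if $\{t: G(t)\cap U\ne\emptyset\}\in\Sigma$ for every open $U\subset W$. $\operatorname{Gr}F(t,\cdot)=\{(a,b)\in Y\times Z: b\in F(t,a)\}$. For a multifunction $S:T\rightrightarrows Y\times Z$, $$\mathsf{Sel}_{\infty,1}\{t\mapsto S(t)\}:=\{(a,b)\in L^\infty(T,Y)\times L^1(T,Z): (a(t),b(t))\in S(t)\text{ a.e.}\}.$$ Clarke tangent cone: for a Banach space $X$, $C\subset X$ closed and $x\in C$, $\widehat{\mathbf T}_C(x)$ is the set of all $v\in X$ such that for every $\varepsilon>0$ there exist $\delta>0$, $\lambda>0$ such that $C\cap[y+\eta(v+\varepsilon\overline{\mathbf B}_X)]\ne\emptyset$ for every $y\in C\cap(x+\delta\overline{\mathbf B}_X)$ and every $\eta\in[0,\lambda]$. *)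

theory Defs
  imports "HOL-Analysis.Analysis" "HOL-Probability.Essential_Supremum"
begin

text \<open>The Lebesgue-Bochner spaces depend on a measure, which is a term, so they cannot be types.
  Normed spaces are therefore given by an explicit carrier and operations. This also allows the
  product norm to be the sum of the norms; the norm of the library's product type is the
  Euclidean one.\<close>

record 'v normed_sp =
  vcarrier :: "'v set"
  vadd :: "'v \<Rightarrow> 'v \<Rightarrow> 'v"
  vscale :: "real \<Rightarrow> 'v \<Rightarrow> 'v"
  vnorm :: "'v \<Rightarrow> real"

definition type_sp :: "'v::real_normed_vector normed_sp" where
  "type_sp = \<lparr>vcarrier = UNIV, vadd = (+), vscale = (*\<^sub>R), vnorm = norm\<rparr>"

definition sum_prod_sp :: "'v normed_sp \<Rightarrow> 'w normed_sp \<Rightarrow> ('v \<times> 'w) normed_sp" where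
  "sum_prod_sp V W =
     \<lparr>vcarrier = vcarrier V \<times> vcarrier W,
      vadd = (\<lambda>p q. (vadd V (fst p) (fst q), vadd W (snd p) (snd q))),
      vscale = (\<lambda>c p. (vscale V c (fst p), vscale W c (snd p))),
      vnorm = (\<lambda>p. vnorm V (fst p) + vnorm W (snd p))\<rparr>"

definition vcball :: "'v normed_sp \<Rightarrow> 'v \<Rightarrow> real \<Rightarrow> 'v set" where
  "vcball X x r = {vadd X x (vscale X r b) | b. b \<in> vcarrier X \<and> vnorm X b \<le> 1}"

definition clarke_tangent_cone :: "'v normed_sp \<Rightarrow> 'v set \<Rightarrow> 'v \<Rightarrow> 'v set" where
  "clarke_tangent_cone X C x =
     {v \<in> vcarrier X. \<forall>\<epsilon>>0. \<exists>\<delta>>0. \<exists>r>0. \<forall>y \<in> C \<inter> vcball X x \<delta>. \<forall>\<eta>\<in>{0..r}.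
        C \<inter> {vadd X y (vscale X \<eta> z) | z. z \<in> vcball X v \<epsilon>} \<noteq> {}}"

text \<open>Elements of the Lebesgue-Bochner spaces are the classes of measurable functions modulo
  equality almost everywhere. For a separable target space, Borel measurability coincides with
  strong measurability.\<close>

definition ae_class :: "'t measure \<Rightarrow> ('t \<Rightarrow> 'b::topological_space) \<Rightarrow> ('t \<Rightarrow> 'b) set" where
  "ae_class M f = {g \<in> borel_measurable M. AE t in M. g t = f t}"

definition ae_rep :: "('t \<Rightarrow> 'b) set \<Rightarrow> 't \<Rightarrow> 'b" where
  "ae_rep A = (SOME f. f \<in> A)"

definition ess_bounded :: "'t measure \<Rightarrow> ('t \<Rightarrow> 'b::real_normed_vector) \<Rightarrow> bool" where
  "ess_bounded M f \<longleftrightarrow>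
     f \<in> borel_measurable M \<and> esssup M (\<lambda>t. ereal (norm (f t))) < \<infinity>"

text \<open>If \<open>M\<close> is the null measure, the essential supremum is \<open>-\<infinity>\<close>, which
  \<open>real_of_ereal\<close> sends to \<open>0\<close>.\<close>

definition Linf_sp ::
  "'t measure \<Rightarrow> ('t \<Rightarrow> 'b::{banach, second_countable_topology}) set normed_sp" where
  "Linf_sp M =
     \<lparr>vcarrier = ae_class M ` {f. ess_bounded M f},
      vadd = (\<lambda>A B. ae_class M (\<lambda>t. ae_rep A t + ae_rep B t)),
      vscale = (\<lambda>c A. ae_class M (\<lambda>t. c *\<^sub>R ae_rep A t)),
      vnorm = (\<lambda>A. real_of_ereal (esssup M (\<lambda>t. ereal (norm (ae_rep A t)))))\<rparr>"

definition L1_sp ::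
  "'t measure \<Rightarrow> ('t \<Rightarrow> 'b::{banach, second_countable_topology}) set normed_sp" where
  "L1_sp M =
     \<lparr>vcarrier = ae_class M ` {f. integrable M f},
      vadd = (\<lambda>A B. ae_class M (\<lambda>t. ae_rep A t + ae_rep B t)),
      vscale = (\<lambda>c A. ae_class M (\<lambda>t. c *\<^sub>R ae_rep A t)),
      vnorm = (\<lambda>A. \<integral>t. norm (ae_rep A t) \<partial>M)\<rparr>"

definition Sel_inf_1 ::
  "'t measure \<Rightarrow>
   ('t \<Rightarrow> ('y::{banach, second_countable_topology} \<times> 'z::{banach, second_countable_topology}) set) \<Rightarrow>
   (('t \<Rightarrow> 'y) set \<times> ('t \<Rightarrow> 'z) set) set" where
  "Sel_inf_1 M S =
     {(ae_class M a, ae_class M b) | a b.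
        ess_bounded M a \<and> integrable M b \<and> (AE t in M. (a t, b t) \<in> S t)}"

definition measurable_multifun ::
  "'t measure \<Rightarrow> ('t \<Rightarrow> 'w::topological_space set) \<Rightarrow> bool" where
  "measurable_multifun M G \<longleftrightarrow>
     (\<forall>U. open U \<longrightarrow> {t \<in> space M. G t \<inter> U \<noteq> {}} \<in> sets M)"

definition gph :: "('y \<Rightarrow> 'z set) \<Rightarrow> ('y \<times> 'z) set" where
  "gph G = {(a, b). b \<in> G a}"

end

theory Submission
  imports Defs
begin

text \<open>
  Let \<open>gap t a b\<close> be the distance of \<open>b\<close> to \<open>F t a\<close>. It is Lipschitz in \<open>(a, b)\<close>, so a
  direction \<open>(u, v)\<close> is tangent to the graph of \<open>F t\<close> iff \<open>gap t (a + \<eta>u) (b + \<eta>v) / \<eta>\<close> tends to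
  \<open>0\<close> as \<open>\<eta>\<close> tends to \<open>0\<close> and \<open>(a, b)\<close> tends to the base point within the graph; by measurable
  selection of near-projections, it is tangent to the set of selections iff the integrals of these
  quotients tend to \<open>0\<close>. The quotients are dominated by \<open>norm v + \<bar>l\<bar> * norm u\<close>, so dominated
  convergence passes from pointwise tangency to tangency of selections. Conversely, if tangency
  fails on a set of positive measure, then perturbing \<open>(x, y)\<close> there by shifts taken from a
  countable dense set, and projecting back onto the graph, gives nearby selections for which the
  integrals stay bounded away from \<open>0\<close>.
\<close>

section \<open>Lebesgue--Bochner spaces and tangent cones in terms of functions\<close>

text \<open>The cone of the set of selections prescribes one scalar step size for all
  \<open>t\<close>, whereas a failure of pointwise tangency supplies a step size that depends on
  \<open>t\<close> and that cannot be chosen. The remedy is in the spirit of Clarke's generalised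
  directional derivative of the distance: increments of \<open>gap\<close> are considered at base
  points off the graph as well, and bad increments of that kind occur at every sufficiently small
  step size. Moving such a base point back to the graph costs its distance to the graph fibre, which
  is exactly the term subtracted in the increment, so only the freely chosen projection error is
  lost.

  The two components play different parts. A direction can always be corrected in \<open>v\<close>
  alone, with \<open>u\<close> kept fixed, so every selection that has to be constructed for a
  direction is controlled by an \<open>L1\<close> estimate. Changes of the first argument cost at
  most \<bar>l\<bar> times their norm, and an integrable \<bar>l\<bar> times an essentially bounded
  norm is integrable; this is how the pairing of the two function spaces fits the Lipschitz
  condition.\<close>

lemma ae_class_self: "f \<in> borel_measurable M \<Longrightarrow> f \<in> ae_class M f"
  by (simp add: ae_class_def)

lemma ae_rep_ae_class:
  assumes "f \<in> borel_measurable M"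
  shows "ae_rep (ae_class M f) \<in> borel_measurable M" "AE t in M. ae_rep (ae_class M f) t = f t"
proof -
  have "ae_rep (ae_class M f) \<in> ae_class M f"
    unfolding ae_rep_def
    using someI[of "\<lambda>g. g \<in> ae_class M f", OF ae_class_self[OF assms]] .
  then show "ae_rep (ae_class M f) \<in> borel_measurable M" "AE t in M. ae_rep (ae_class M f) t = f t"
    by (auto simp: ae_class_def)
qed

lemma ae_class_eqI: "AE t in M. f t = g t \<Longrightarrow> ae_class M f = ae_class M g"
  unfolding ae_class_def by (auto elim: AE_mp)

lemma ae_class_eqD:
  assumes "ae_class M f = ae_class M g" "f \<in> borel_measurable M"
  shows "AE t in M. f t = g t"
  using ae_class_self[OF assms(2)] unfolding assms(1) by (simp add: ae_class_def)

section \<open>Norms and essential bounds of representatives\<close>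

definition Linf_norm :: "'t measure \<Rightarrow> ('t \<Rightarrow> 'b::real_normed_vector) \<Rightarrow> real" where
  "Linf_norm M f = real_of_ereal (esssup M (\<lambda>t. ereal (norm (f t))))"

definition L1_norm :: "'t measure \<Rightarrow> ('t \<Rightarrow> 'b::real_normed_vector) \<Rightarrow> real" where
  "L1_norm M f = (\<integral>t. norm (f t) \<partial>M)"

lemma ess_bounded_iff:
  "ess_bounded M f \<longleftrightarrow> f \<in> borel_measurable M \<and> (\<exists>c. AE t in M. norm (f t) \<le> c)"
proof
  assume *: "ess_bounded M f"
  then have m: "f \<in> borel_measurable M" and lt: "esssup M (\<lambda>t. ereal (norm (f t))) < \<infinity>"
    by (auto simp: ess_bounded_def)
  then obtain c :: real where c: "esssup M (\<lambda>t. ereal (norm (f t))) < ereal c"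
    using less_PInf_Ex_of_nat by (metis ereal_dense2)
  have "AE t in M. ereal (norm (f t)) \<le> esssup M (\<lambda>t. ereal (norm (f t)))"
    by (rule esssup_AE)
  then have "AE t in M. norm (f t) \<le> c"
    by eventually_elim (metis c ereal_less_eq(3) less_imp_le order_trans)
  with m show "f \<in> borel_measurable M \<and> (\<exists>c. AE t in M. norm (f t) \<le> c)" by blast
next
  assume "f \<in> borel_measurable M \<and> (\<exists>c. AE t in M. norm (f t) \<le> c)"
  then obtain c where [measurable]: "f \<in> borel_measurable M" and c: "AE t in M. norm (f t) \<le> c"
    by blast
  have "esssup M (\<lambda>t. ereal (norm (f t))) \<le> ereal c"
    by (rule esssup_I) (use c in auto)
  then show "ess_bounded M f"
    by (auto simp: ess_bounded_def)
qed

lemma ess_bounded_measurable: "ess_bounded M f \<Longrightarrow> f \<in> borel_measurable M"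
  by (simp add: ess_bounded_def)

lemma Linf_norm_AE:
  assumes "ess_bounded M f" shows "AE t in M. norm (f t) \<le> Linf_norm M f"
proof -
  have "esssup M (\<lambda>t. ereal (norm (f t))) \<noteq> \<infinity>"
    using assms by (auto simp: ess_bounded_def)
  then have "norm (f t) \<le> Linf_norm M f" if "ereal (norm (f t)) \<le> esssup M (\<lambda>t. ereal (norm (f t)))" for t
    using that unfolding Linf_norm_def by (cases "esssup M (\<lambda>t. ereal (norm (f t)))") auto
  with esssup_AE[of "\<lambda>t. ereal (norm (f t))" M] show ?thesis by (auto elim: eventually_mono)
qed

lemma Linf_norm_le:
  assumes "f \<in> borel_measurable M" "AE t in M. norm (f t) \<le> c" "0 \<le> c"
  shows "Linf_norm M f \<le> c"
proof -
  have [measurable]: "f \<in> borel_measurable M" by fact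
  have "esssup M (\<lambda>t. ereal (norm (f t))) \<le> ereal c"
    by (rule esssup_I) (use assms in auto)
  then show ?thesis
    unfolding Linf_norm_def using assms(3)
    by (cases "esssup M (\<lambda>t. ereal (norm (f t)))") auto
qed

lemma L1_norm_nonneg: "0 \<le> L1_norm M f"
  unfolding L1_norm_def by simp

lemma Linf_norm_nonneg:
  fixes f :: "'t \<Rightarrow> 'b::{real_normed_vector, second_countable_topology}"
  assumes "ess_bounded M f"
  shows "0 \<le> Linf_norm M f"
\<comment> \<open>On a null space almost-everywhere statements are vacuous and bound nothing; there
  the essential supremum is -\<infinity>, which \<open>real_of_ereal\<close> sends to
  \<open>0\<close>. On any other space a constant inequality that holds almost everywhere holds
  outright.\<close>
proof (cases "emeasure M (space M) = 0")
  case True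
  have [measurable]: "f \<in> borel_measurable M" using assms by (rule ess_bounded_measurable)
  have "esssup M (\<lambda>t. ereal (norm (f t))) = - \<infinity>"
    by (rule esssup_zero_space) (use True in auto)
  then show ?thesis by (simp add: Linf_norm_def)
next
  case False
  from Linf_norm_AE[OF assms] have "AE t in M. 0 \<le> Linf_norm M f"
    by eventually_elim (metis norm_ge_zero order_trans)
  then show ?thesis using False by (simp add: eventually_const ae_filter_eq_bot_iff)
qed

lemma ess_bounded_lin:
  fixes f g :: "'t \<Rightarrow> 'b::{real_normed_vector, second_countable_topology}"
  assumes "ess_bounded M f" "ess_bounded M g"
  shows "ess_bounded M (\<lambda>t. f t + c *\<^sub>R g t)"
proof -
  obtain A B where [measurable]: "f \<in> borel_measurable M" "g \<in> borel_measurable M"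
    and *: "AE t in M. norm (f t) \<le> A" "AE t in M. norm (g t) \<le> B"
    using assms unfolding ess_bounded_iff by blast
  from * have "AE t in M. norm (f t + c *\<^sub>R g t) \<le> A + \<bar>c\<bar> * B"
    by eventually_elim (rule norm_triangle_le, auto intro!: add_mono mult_left_mono)
  then show ?thesis unfolding ess_bounded_iff by (intro conjI exI) auto
qed

lemma ess_bounded_diff:
  fixes f g :: "'t \<Rightarrow> 'b::{real_normed_vector, second_countable_topology}"
  assumes "ess_bounded M f" "ess_bounded M g"
  shows "ess_bounded M (\<lambda>t. f t - g t)"
  using ess_bounded_lin[OF assms, of "-1"] by simp

lemma ess_bounded_cong_AE:
  fixes f g :: "'t \<Rightarrow> 'b::{real_normed_vector, second_countable_topology}"
  assumes "ess_bounded M f" "AE t in M. f t = g t" "g \<in> borel_measurable M"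
  shows "ess_bounded M g"
proof -
  obtain A where "AE t in M. norm (f t) \<le> A" using assms(1) unfolding ess_bounded_iff by blast
  with assms(2) have "AE t in M. norm (g t) \<le> A" by eventually_elim simp
  with assms(3) show ?thesis unfolding ess_bounded_iff by blast
qed

lemma Linf_norm_cong_AE:
  fixes f g :: "'t \<Rightarrow> 'b::{real_normed_vector, second_countable_topology}"
  assumes "AE t in M. f t = g t" "f \<in> borel_measurable M" "g \<in> borel_measurable M"
  shows "Linf_norm M f = Linf_norm M g"
proof -
  note [measurable] = assms(2,3)
  have "esssup M (\<lambda>t. ereal (norm (f t))) = esssup M (\<lambda>t. ereal (norm (g t)))"
    by (rule esssup_AE_cong) (use assms(1) in auto)
  then show ?thesis by (simp add: Linf_norm_def)
qed

text \<open>The inequality suffices for rescaling balls, since it is used with the factor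
  \<open>r\<close> and with the factor \<open>1/r\<close>.\<close>

lemma Linf_norm_scale_le:
  fixes f :: "'t \<Rightarrow> 'b::{real_normed_vector, second_countable_topology}"
  assumes "ess_bounded M f"
  shows "Linf_norm M (\<lambda>t. c *\<^sub>R f t) \<le> \<bar>c\<bar> * Linf_norm M f"
proof (rule Linf_norm_le)
  have [measurable]: "f \<in> borel_measurable M" using assms by (rule ess_bounded_measurable)
  show "(\<lambda>t. c *\<^sub>R f t) \<in> borel_measurable M" by measurable
  show "AE t in M. norm (c *\<^sub>R f t) \<le> \<bar>c\<bar> * Linf_norm M f"
    using Linf_norm_AE[OF assms] by eventually_elim (simp add: mult_left_mono)
qed (simp add: Linf_norm_nonneg[OF assms])

lemma L1_norm_cong_AE:
  fixes f g :: "'t \<Rightarrow> 'b::{real_normed_vector, second_countable_topology}"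
  assumes "AE t in M. f t = g t" "f \<in> borel_measurable M" "g \<in> borel_measurable M"
  shows "L1_norm M f = L1_norm M g"
  unfolding L1_norm_def using assms by (intro integral_cong_AE) auto

lemma L1_norm_scale: "L1_norm M (\<lambda>t. c *\<^sub>R f t) = \<bar>c\<bar> * L1_norm M f"
  unfolding L1_norm_def by simp

section \<open>Operations, balls and tangency in the product space, in terms of
  representatives\<close>

context
  fixes M :: "'t measure"
begin

abbreviation (input) Linf_L1_sp ::
  "(('t \<Rightarrow> 'y::{banach, second_countable_topology}) set \<times>
    ('t \<Rightarrow> 'z::{banach, second_countable_topology}) set) normed_sp" where
  "Linf_L1_sp \<equiv> sum_prod_sp (Linf_sp M) (L1_sp M)"

text \<open>The nested choices are what unfolding \<open>vadd\<close> after \<open>vscale\<close>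
  produces, as each operation picks representatives of its arguments. There are three choices, and
  each agrees almost everywhere with the function whose class it represents.\<close>

lemma ae_class_rep_lin:
  fixes f g :: "'t \<Rightarrow> 'b::{banach, second_countable_topology}"
  assumes "f \<in> borel_measurable M" "g \<in> borel_measurable M"
  shows "ae_class M (\<lambda>t. ae_rep (ae_class M f) t + ae_rep (ae_class M (\<lambda>t. c *\<^sub>R ae_rep (ae_class M g) t)) t)
    = ae_class M (\<lambda>t. f t + c *\<^sub>R g t)"
proof (rule ae_class_eqI)
  note [measurable] = assms ae_rep_ae_class(1)[OF assms(1)] ae_rep_ae_class(1)[OF assms(2)]
  have "AE t in M. ae_rep (ae_class M (\<lambda>t. c *\<^sub>R ae_rep (ae_class M g) t)) t = c *\<^sub>R ae_rep (ae_class M g) t"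
    by (rule ae_rep_ae_class) measurable
  with ae_rep_ae_class(2)[OF assms(1)] ae_rep_ae_class(2)[OF assms(2)]
  show "AE t in M. ae_rep (ae_class M f) t + ae_rep (ae_class M (\<lambda>t. c *\<^sub>R ae_rep (ae_class M g) t)) t
    = f t + c *\<^sub>R g t"
    by eventually_elim simp
qed

lemma Linf_L1_sp_lin:
  assumes "f \<in> borel_measurable M" "g \<in> borel_measurable M"
    "h \<in> borel_measurable M" "k \<in> borel_measurable M"
  shows "vadd Linf_L1_sp (ae_class M f, ae_class M g) (vscale Linf_L1_sp c (ae_class M h, ae_class M k))
    = (ae_class M (\<lambda>t. f t + c *\<^sub>R h t), ae_class M (\<lambda>t. g t + c *\<^sub>R k t))"
  using assms by (simp add: sum_prod_sp_def Linf_sp_def L1_sp_def ae_class_rep_lin)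

lemma Linf_L1_sp_norm:
  fixes f :: "'t \<Rightarrow> 'y::{banach, second_countable_topology}"
    and g :: "'t \<Rightarrow> 'z::{banach, second_countable_topology}"
  assumes "f \<in> borel_measurable M" "g \<in> borel_measurable M"
  shows "vnorm Linf_L1_sp (ae_class M f, ae_class M g) = Linf_norm M f + L1_norm M g"
  using Linf_norm_cong_AE[OF ae_rep_ae_class(2,1)[OF assms(1)] assms(1)]
    L1_norm_cong_AE[OF ae_rep_ae_class(2,1)[OF assms(2)] assms(2)]
  by (simp add: sum_prod_sp_def Linf_sp_def L1_sp_def Linf_norm_def L1_norm_def)

lemma Linf_L1_sp_carrier:
  "vcarrier Linf_L1_sp = {(ae_class M f, ae_class M g) | f g. ess_bounded M f \<and> integrable M g}"
  by (auto simp: sum_prod_sp_def Linf_sp_def L1_sp_def)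

text \<open>\<open>vcball\<close> is an image of the unit ball; the substitution
  \<open>a = x + r * f\<close>, \<open>b = y + r * g\<close> and its inverse turn this into a
  condition on the distance to the centre.\<close>

lemma Linf_L1_sp_vcball:
  fixes x :: "'t \<Rightarrow> 'y::{banach, second_countable_topology}"
    and y :: "'t \<Rightarrow> 'z::{banach, second_countable_topology}"
  assumes x: "ess_bounded M x" and y: "integrable M y" and r: "r > 0"
  shows "vcball Linf_L1_sp (ae_class M x, ae_class M y) r = {(ae_class M a, ae_class M b) | a b.
      ess_bounded M a \<and> integrable M b \<and>
      Linf_norm M (\<lambda>t. a t - x t) + L1_norm M (\<lambda>t. b t - y t) \<le> r}" (is "?L = ?R")
proof (intro equalityI subsetI)
  note [measurable] = ess_bounded_measurable[OF x] borel_measurable_integrable[OF y]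
  fix w assume "w \<in> ?L"
  then obtain b where b: "b \<in> vcarrier Linf_L1_sp" "vnorm Linf_L1_sp b \<le> 1"
    and w: "w = vadd Linf_L1_sp (ae_class M x, ae_class M y) (vscale Linf_L1_sp r b)"
    unfolding vcball_def by blast
  from b obtain f g where fg: "ess_bounded M f" "integrable M g" "b = (ae_class M f, ae_class M g)"
    unfolding Linf_L1_sp_carrier by blast
  note [measurable] = ess_bounded_measurable[OF fg(1)] borel_measurable_integrable[OF fg(2)]
  have n: "Linf_norm M f + L1_norm M g \<le> 1" using b(2) by (simp add: fg(3) Linf_L1_sp_norm)
  have "Linf_norm M (\<lambda>t. r *\<^sub>R f t) + L1_norm M (\<lambda>t. r *\<^sub>R g t) \<le> r * (Linf_norm M f + L1_norm M g)"
    using Linf_norm_scale_le[OF fg(1), of r] r by (simp add: L1_norm_scale algebra_simps)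
  also have "\<dots> \<le> r" using mult_left_mono[OF n, of r] r by simp
  finally have "Linf_norm M (\<lambda>t. (x t + r *\<^sub>R f t) - x t) + L1_norm M (\<lambda>t. (y t + r *\<^sub>R g t) - y t) \<le> r"
    by simp
  moreover have "w = (ae_class M (\<lambda>t. x t + r *\<^sub>R f t), ae_class M (\<lambda>t. y t + r *\<^sub>R g t))"
    unfolding w fg(3) by (rule Linf_L1_sp_lin) measurable
  moreover have "ess_bounded M (\<lambda>t. x t + r *\<^sub>R f t)" by (rule ess_bounded_lin[OF x fg(1)])
  moreover have "integrable M (\<lambda>t. y t + r *\<^sub>R g t)" using y fg(2) by simp
  ultimately show "w \<in> ?R" by blast
next
  note [measurable] = ess_bounded_measurable[OF x] borel_measurable_integrable[OF y]
  fix w assume "w \<in> ?R"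
  then obtain a b where ab: "ess_bounded M a" "integrable M b" "w = (ae_class M a, ae_class M b)"
    "Linf_norm M (\<lambda>t. a t - x t) + L1_norm M (\<lambda>t. b t - y t) \<le> r" by blast
  note [measurable] = ess_bounded_measurable[OF ab(1)] borel_measurable_integrable[OF ab(2)]
  define f where "f t = (1/r) *\<^sub>R (a t - x t)" for t
  define g where "g t = (1/r) *\<^sub>R (b t - y t)" for t
  have d: "ess_bounded M (\<lambda>t. a t - x t)" by (rule ess_bounded_diff[OF ab(1) x])
  \<comment> \<open>The factor \<open>1/r\<close> is split as \<open>1 + (1/r - 1)\<close> to match
    the form of \<open>ess_bounded_lin\<close>.\<close>
  have f: "ess_bounded M f"
    using ess_bounded_lin[OF d d, of "1/r - 1"] unfolding f_def by (simp add: scaleR_left_diff_distrib)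
  have g: "integrable M g" unfolding g_def using ab(2) y by auto
  note [measurable] = ess_bounded_measurable[OF f] borel_measurable_integrable[OF g]
  have "Linf_norm M f + L1_norm M g \<le> (1/r) * (Linf_norm M (\<lambda>t. a t - x t) + L1_norm M (\<lambda>t. b t - y t))"
    using Linf_norm_scale_le[OF d, of "1/r"] r L1_norm_scale[of M "1/r" "\<lambda>t. b t - y t"]
    by (simp add: f_def[abs_def] g_def[abs_def] algebra_simps)
  also have "\<dots> \<le> 1" using ab(4) r by (simp add: field_simps)
  finally have "vnorm Linf_L1_sp (ae_class M f, ae_class M g) \<le> 1" by (simp add: Linf_L1_sp_norm)
  moreover have "(ae_class M f, ae_class M g) \<in> vcarrier Linf_L1_sp" unfolding Linf_L1_sp_carrier using f g by blast
  moreover have "w = vadd Linf_L1_sp (ae_class M x, ae_class M y) (vscale Linf_L1_sp r (ae_class M f, ae_class M g))"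
  proof -
    have "vadd Linf_L1_sp (ae_class M x, ae_class M y) (vscale Linf_L1_sp r (ae_class M f, ae_class M g)) =
      (ae_class M (\<lambda>t. x t + r *\<^sub>R f t), ae_class M (\<lambda>t. y t + r *\<^sub>R g t))"
      by (rule Linf_L1_sp_lin) measurable
    then show ?thesis using r by (simp add: ab(3) f_def g_def)
  qed
  ultimately show "w \<in> ?L" unfolding vcball_def by blast
qed

text \<open>The definition asks for some pair of representatives. All three conditions are invariant
  under almost-everywhere equality of measurable functions, so any given pair can be tested.\<close>

lemma Sel_inf_1_iff:
  fixes a :: "'t \<Rightarrow> 'y::{banach, second_countable_topology}"
    and b :: "'t \<Rightarrow> 'z::{banach, second_countable_topology}"
  assumes a: "a \<in> borel_measurable M" and b: "b \<in> borel_measurable M"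
  shows "(ae_class M a, ae_class M b) \<in> Sel_inf_1 M S \<longleftrightarrow>
    ess_bounded M a \<and> integrable M b \<and> (AE t in M. (a t, b t) \<in> S t)"
proof
  assume "(ae_class M a, ae_class M b) \<in> Sel_inf_1 M S"
  then obtain a' b' where *: "ae_class M a = ae_class M a'" "ae_class M b = ae_class M b'"
    "ess_bounded M a'" "integrable M b'" "AE t in M. (a' t, b' t) \<in> S t"
    unfolding Sel_inf_1_def by blast
  have eq: "AE t in M. a t = a' t" "AE t in M. b t = b' t"
    using ae_class_eqD[OF *(1) a] ae_class_eqD[OF *(2) b] by auto
  have "AE t in M. a' t = a t" using eq(1) by eventually_elim simp
  then have "ess_bounded M a" using ess_bounded_cong_AE[OF *(3) _ a] by blast
  moreover have "integrable M b"
    using integrable_cong_AE[OF b borel_measurable_integrable[OF *(4)] eq(2)] *(4) by simp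
  moreover have "AE t in M. (a t, b t) \<in> S t" using eq *(5) by eventually_elim simp
  ultimately show "ess_bounded M a \<and> integrable M b \<and> (AE t in M. (a t, b t) \<in> S t)" by simp
qed (auto simp: Sel_inf_1_def)

text \<open>The Clarke condition for the set of selections with every class replaced by a
  representative, so that what follows concerns functions and integrals only.\<close>

definition Sel_tangent ::
  "('t \<Rightarrow> ('y::{banach, second_countable_topology} \<times> 'z::{banach, second_countable_topology}) set) \<Rightarrow>
   ('t \<Rightarrow> 'y) \<Rightarrow> ('t \<Rightarrow> 'z) \<Rightarrow> ('t \<Rightarrow> 'y) \<Rightarrow> ('t \<Rightarrow> 'z) \<Rightarrow> bool" where
  "Sel_tangent S x y u v \<longleftrightarrow> (\<forall>\<epsilon>>0. \<exists>\<delta>>0. \<exists>r>0. \<forall>a b. ess_bounded M a \<longrightarrow> integrable M b \<longrightarrow>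
     (AE t in M. (a t, b t) \<in> S t) \<longrightarrow>
     Linf_norm M (\<lambda>t. a t - x t) + L1_norm M (\<lambda>t. b t - y t) \<le> \<delta> \<longrightarrow>
     (\<forall>\<eta>\<in>{0..r}. \<exists>u' v'. ess_bounded M u' \<and> integrable M v' \<and>
        Linf_norm M (\<lambda>t. u' t - u t) + L1_norm M (\<lambda>t. v' t - v t) \<le> \<epsilon> \<and>
        (AE t in M. (a t + \<eta> *\<^sub>R u' t, b t + \<eta> *\<^sub>R v' t) \<in> S t)))"

lemma clarke_tangent_cone_Sel_iff:
  fixes x u :: "'t \<Rightarrow> 'y::{banach, second_countable_topology}"
    and y v :: "'t \<Rightarrow> 'z::{banach, second_countable_topology}"
  assumes x: "ess_bounded M x" and y: "integrable M y" and u: "ess_bounded M u" and v: "integrable M v"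
  shows "(ae_class M u, ae_class M v) \<in>
      clarke_tangent_cone Linf_L1_sp (Sel_inf_1 M S) (ae_class M x, ae_class M y) \<longleftrightarrow> Sel_tangent S x y u v"
proof -
  have step: "Sel_inf_1 M S \<inter> {vadd Linf_L1_sp (ae_class M a, ae_class M b) (vscale Linf_L1_sp \<eta> z) | z.
       z \<in> vcball Linf_L1_sp (ae_class M u, ae_class M v) \<epsilon>} \<noteq> {} \<longleftrightarrow>
     (\<exists>u' v'. ess_bounded M u' \<and> integrable M v' \<and>
        Linf_norm M (\<lambda>t. u' t - u t) + L1_norm M (\<lambda>t. v' t - v t) \<le> \<epsilon> \<and>
        (AE t in M. (a t + \<eta> *\<^sub>R u' t, b t + \<eta> *\<^sub>R v' t) \<in> S t))" (is "?L \<longleftrightarrow> ?R")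
    if a: "ess_bounded M a" and b: "integrable M b" and "\<epsilon> > 0" for a b \<eta> \<epsilon>
  proof -
    have mem: "vadd Linf_L1_sp (ae_class M a, ae_class M b) (vscale Linf_L1_sp \<eta> (ae_class M u', ae_class M v')) \<in> Sel_inf_1 M S
      \<longleftrightarrow> (AE t in M. (a t + \<eta> *\<^sub>R u' t, b t + \<eta> *\<^sub>R v' t) \<in> S t)"
      if u': "ess_bounded M u'" and v': "integrable M v'" for u' v'
    proof -
      note [measurable] = ess_bounded_measurable[OF a] borel_measurable_integrable[OF b]
        ess_bounded_measurable[OF u'] borel_measurable_integrable[OF v']
      have "integrable M (\<lambda>t. b t + \<eta> *\<^sub>R v' t)" using b v' by simp
      with ess_bounded_lin[OF a u'] show ?thesis
        by (subst Linf_L1_sp_lin) (simp_all add: Sel_inf_1_iff)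
    qed
    have "?L \<longleftrightarrow> (\<exists>z \<in> vcball Linf_L1_sp (ae_class M u, ae_class M v) \<epsilon>.
        vadd Linf_L1_sp (ae_class M a, ae_class M b) (vscale Linf_L1_sp \<eta> z) \<in> Sel_inf_1 M S)" by blast
    also have "\<dots> \<longleftrightarrow> ?R"
      unfolding Linf_L1_sp_vcball[OF u v \<open>\<epsilon> > 0\<close>] using mem by blast
    finally show ?thesis .
  qed
  have pt: "(\<forall>w \<in> Sel_inf_1 M S \<inter> vcball Linf_L1_sp (ae_class M x, ae_class M y) \<delta>. Q w) \<longleftrightarrow>
    (\<forall>a b. ess_bounded M a \<longrightarrow> integrable M b \<longrightarrow> (AE t in M. (a t, b t) \<in> S t) \<longrightarrow>
     Linf_norm M (\<lambda>t. a t - x t) + L1_norm M (\<lambda>t. b t - y t) \<le> \<delta> \<longrightarrow> Q (ae_class M a, ae_class M b))"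
    if "\<delta> > 0" for \<delta> Q
  proof -
    have mem: "(ae_class M a, ae_class M b) \<in> Sel_inf_1 M S \<longleftrightarrow> (AE t in M. (a t, b t) \<in> S t)"
      if "ess_bounded M a" "integrable M b" for a b
      using that by (simp add: Sel_inf_1_iff ess_bounded_measurable borel_measurable_integrable)
    show ?thesis unfolding Linf_L1_sp_vcball[OF x y that] using mem by blast
  qed
  have c: "(ae_class M u, ae_class M v) \<in> vcarrier Linf_L1_sp" unfolding Linf_L1_sp_carrier using u v by blast
  \<comment> \<open>The congruence rules keep the positivity of \<epsilon> and \<delta> as
    assumptions; \<open>step\<close> and \<open>pt\<close> need it to describe the balls.\<close>
  show ?thesis
    unfolding clarke_tangent_cone_def Sel_tangent_def mem_Collect_eq
    by (simp only: c simp_thms,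
        intro iff_allI imp_cong iff_exI conj_cong refl, simp only: pt,
        intro iff_allI imp_cong ball_cong refl step)
qed

end

lemma clarke_tangent_cone_gph_iff:
  fixes x u :: "'y::real_normed_vector" and y v :: "'z::real_normed_vector"
  shows "(u, v) \<in> clarke_tangent_cone (sum_prod_sp type_sp type_sp) (gph G) (x, y) \<longleftrightarrow>
   (\<forall>\<epsilon>>0. \<exists>\<delta>>0. \<exists>r>0. \<forall>a b. b \<in> G a \<longrightarrow> norm (a - x) + norm (b - y) \<le> \<delta> \<longrightarrow>
     (\<forall>\<eta>\<in>{0..r}. \<exists>u' v'. norm (u' - u) + norm (v' - v) \<le> \<epsilon> \<and> b + \<eta> *\<^sub>R v' \<in> G (a + \<eta> *\<^sub>R u')))"
proof -
  have vcball: "vcball (sum_prod_sp type_sp type_sp) (p, q) r =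
    {(a, b). norm (a - p) + norm (b - q) \<le> r}" (is "?L = ?R") if r: "r > 0"
    for r and p :: 'y and q :: 'z
  proof (intro equalityI subsetI)
    fix w assume "w \<in> ?L"
    then obtain f g where fg: "norm f + norm g \<le> 1" "w = (p + r *\<^sub>R f, q + r *\<^sub>R g)"
      by (auto simp: vcball_def sum_prod_sp_def type_sp_def)
    have "r * (norm f + norm g) \<le> r" using mult_left_mono[OF fg(1), of r] r by simp
    then show "w \<in> ?R" using r by (simp add: fg(2) algebra_simps)
  next
    fix w assume "w \<in> ?R"
    then obtain a b where ab: "w = (a, b)" "norm (a - p) + norm (b - q) \<le> r" by auto
    have "w = (p + r *\<^sub>R ((1/r) *\<^sub>R (a - p)), q + r *\<^sub>R ((1/r) *\<^sub>R (b - q)))"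
      using r by (simp add: ab(1))
    moreover have "norm ((1/r) *\<^sub>R (a - p)) + norm ((1/r) *\<^sub>R (b - q)) \<le> 1"
      using ab(2) r by (simp only: norm_scaleR) (simp add: field_simps)
    ultimately show "w \<in> ?L"
      unfolding vcball_def sum_prod_sp_def type_sp_def
      by (intro CollectI exI[of _ "((1/r) *\<^sub>R (a - p), (1/r) *\<^sub>R (b - q))"]) simp
  qed
  have step: "gph G \<inter> {vadd (sum_prod_sp type_sp type_sp) (a, b) (vscale (sum_prod_sp type_sp type_sp) \<eta> z) | z.
       z \<in> vcball (sum_prod_sp type_sp type_sp) (u, v) \<epsilon>} \<noteq> {} \<longleftrightarrow>
    (\<exists>u' v'. norm (u' - u) + norm (v' - v) \<le> \<epsilon> \<and> b + \<eta> *\<^sub>R v' \<in> G (a + \<eta> *\<^sub>R u'))"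
    if "\<epsilon> > 0" for a b \<eta> \<epsilon>
    unfolding vcball[OF that] by (auto simp: gph_def sum_prod_sp_def type_sp_def)
  have pt: "(\<forall>w \<in> gph G \<inter> vcball (sum_prod_sp type_sp type_sp) (x, y) \<delta>. Q w) \<longleftrightarrow>
     (\<forall>a b. b \<in> G a \<longrightarrow> norm (a - x) + norm (b - y) \<le> \<delta> \<longrightarrow> Q (a, b))" if "\<delta> > 0" for \<delta> Q
    unfolding vcball[OF that] by (auto simp: gph_def)
  have c: "(u, v) \<in> vcarrier (sum_prod_sp type_sp type_sp)" by (simp add: sum_prod_sp_def type_sp_def)
  show ?thesis
    unfolding clarke_tangent_cone_def mem_Collect_eq
    by (simp only: c simp_thms,
        intro iff_allI imp_cong iff_exI conj_cong refl, simp only: pt,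
        intro iff_allI imp_cong ball_cong refl step)
qed

section \<open>Measurable near-projections\<close>

text \<open>Along a simple function only finitely many values of \<open>p\<close> occur, so the
  composition is measurable piece by piece; continuity in \<open>p\<close> passes this to the
  pointwise limit of simple functions.\<close>

lemma measurable_Caratheodory:
  fixes f :: "'t \<Rightarrow> 'p::{metric_space, second_countable_topology} \<Rightarrow> 'q::metric_space"
  assumes f: "\<And>p. (\<lambda>t. f t p) \<in> borel_measurable M"
    and cont: "\<And>t. t \<in> space M \<Longrightarrow> continuous_on UNIV (f t)"
    and w: "w \<in> borel_measurable M"
  shows "(\<lambda>t. f t (w t)) \<in> borel_measurable M"
proof -
  obtain s where s: "\<And>i. simple_function M (s i)"
    and lim: "\<And>t. t \<in> space M \<Longrightarrow> (\<lambda>i. s i t) \<longlonglongrightarrow> w t"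
    using borel_measurable_implies_sequence_metric[OF w] by blast
  show ?thesis
  proof (rule borel_measurable_LIMSEQ_metric)
    show "(\<lambda>t. f t (s i t)) \<in> borel_measurable M" for i
    proof (rule measurable_compose_countable'[OF f])
      show "s i \<in> measurable M (count_space (s i ` space M))"
        using simple_function_measurable2[OF s[of i] s[of i]] s[of i]
        by (auto simp: measurable_count_space_eq2 simple_function_def)
      show "countable (s i ` space M)" using s[of i] by (simp add: simple_function_def countable_finite)
    qed
    show "(\<lambda>i. f t (s i t)) \<longlonglongrightarrow> f t (w t)" if "t \<in> space M" for t
      using continuous_on_tendsto_compose[OF cont[OF that] lim[OF that]] by simp
  qed
qed

lemma infdist_less_witness:
  assumes "G \<noteq> {}" "infdist p G < r"
  obtains c where "c \<in> G" "dist p c < r"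
proof -
  have "(INF c\<in>G. dist p c) < r" using assms by (simp add: infdist_def)
  then show ?thesis using that cINF_less_iff[OF assms(1), of "\<lambda>c. dist p c" r] by auto
qed

lemma dense_sequence_exists:
  "\<exists>e :: nat \<Rightarrow> 'a::second_countable_topology. \<forall>X. open X \<longrightarrow> X \<noteq> {} \<longrightarrow> (\<exists>k. e k \<in> X)"
proof -
  obtain D :: "'a set" where D: "countable D" "\<And>X. open X \<Longrightarrow> X \<noteq> {} \<Longrightarrow> \<exists>d\<in>D. d \<in> X"
    by (erule countable_dense_setE)
  have "\<exists>k. from_nat_into D k \<in> X" if "open X" "X \<noteq> {}" for X
    using D(2)[OF that] from_nat_into_surj[OF D(1)] by metis
  then show ?thesis by blast
qed

text \<open>The two strict inequalities cut out an open set of candidates, which contains a point of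
  \<open>G t\<close> that nearly realises the distance. Hence a dense sequence meets it, and the
  first index that does so depends measurably on \<open>t\<close>.\<close>

lemma approximate_projection_step:
  fixes G :: "'t \<Rightarrow> 'z::{metric_space, second_countable_topology} set"
  assumes ne: "\<And>t. t \<in> space M \<Longrightarrow> G t \<noteq> {}"
    and G: "\<And>z. (\<lambda>t. infdist z (G t)) \<in> borel_measurable M"
    and p[measurable]: "p \<in> borel_measurable M"
    and \<rho>[measurable]: "\<rho> \<in> borel_measurable M" and pos: "\<And>t. t \<in> space M \<Longrightarrow> 0 < (\<rho> t :: real)"
  shows "\<exists>q \<in> borel_measurable M. \<forall>t \<in> space M. infdist (q t) (G t) < \<rho> t \<and>
    dist (q t) (p t) < infdist (p t) (G t) + \<rho> t"
proof -
  obtain e :: "nat \<Rightarrow> 'z" where e: "\<And>X. open X \<Longrightarrow> X \<noteq> {} \<Longrightarrow> \<exists>k. e k \<in> X"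
    using dense_sequence_exists by blast
  note [measurable] = G
  have [measurable]: "(\<lambda>t. infdist (p t) (G t)) \<in> borel_measurable M"
    by (rule measurable_Caratheodory[where f="\<lambda>t z. infdist z (G t)"]) (auto intro: continuous_intros)
  define P where "P k t \<longleftrightarrow> infdist (e k) (G t) < \<rho> t \<and> dist (e k) (p t) < infdist (p t) (G t) + \<rho> t" for k t
  have [measurable]: "Measurable.pred M (P k)" for k
    unfolding P_def[abs_def] by measurable
  define q where "q t = e (LEAST k. P k t)" for t
  have "(\<lambda>t. LEAST k. P k t) \<in> measurable M (count_space UNIV)" by measurable
  then have q: "q \<in> borel_measurable M" unfolding q_def[abs_def]
    by (rule measurable_compose) simp
  have "P (LEAST k. P k t) t" if t: "t \<in> space M" for t
  proof (rule LeastI_ex)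
    obtain c where c: "c \<in> G t" "dist (p t) c < infdist (p t) (G t) + \<rho> t"
      using infdist_less_witness[OF ne[OF t], of "p t" "infdist (p t) (G t) + \<rho> t"] pos[OF t] by auto
    define X where "X = {z. infdist z (G t) < \<rho> t} \<inter> {z. dist z (p t) < infdist (p t) (G t) + \<rho> t}"
    have "open X" unfolding X_def by (intro open_Int open_Collect_less continuous_intros)
    moreover have "c \<in> X" using c pos[OF t] by (simp add: X_def dist_commute)
    ultimately show "\<exists>k. P k t" using e[of X] by (auto simp: X_def P_def)
  qed
  with q show ?thesis by (intro bexI[of _ q]) (auto simp: P_def q_def)
qed

text \<open>The Kuratowski--Ryll-Nardzewski construction, started at \<open>p\<close>.\<close>

lemma measurable_near_projection:
  fixes G :: "'t \<Rightarrow> 'z::{banach, second_countable_topology} set"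
  assumes G: "\<And>t. t \<in> space M \<Longrightarrow> G t \<noteq> {} \<and> closed (G t)"
    and mG: "\<And>z. (\<lambda>t. infdist z (G t)) \<in> borel_measurable M"
    and p: "p \<in> borel_measurable M"
    and \<rho>[measurable]: "\<rho> \<in> borel_measurable M" and pos: "\<And>t. t \<in> space M \<Longrightarrow> 0 < (\<rho> t :: real)"
  obtains q where "q \<in> borel_measurable M"
    "\<And>t. t \<in> space M \<Longrightarrow> q t \<in> G t"
    "\<And>t. t \<in> space M \<Longrightarrow> dist (q t) (p t) \<le> infdist (p t) (G t) + \<rho> t"
proof -
  have ne: "\<And>t. t \<in> space M \<Longrightarrow> G t \<noteq> {}" using G by blast
  \<comment> \<open>Consecutive iterates are less than
    \<open>\<sigma> n t + \<sigma> (Suc n) t\<close>, that is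
    \<open>3 * \<rho> t / 8 * (1/2)^n\<close>, apart. These bounds sum to
    \<open>3 * \<rho> t / 4\<close>, and the starting iterate uses up the remaining
    \<open>\<rho> t / 4\<close>.\<close>
  define \<sigma> where "\<sigma> n t = \<rho> t / 4 * (1/2)^n" for n t
  have \<sigma>: "\<sigma> n \<in> borel_measurable M" "t \<in> space M \<Longrightarrow> 0 < \<sigma> n t" for n t
    using pos[of t] unfolding \<sigma>_def[abs_def] by auto
  obtain q0 where q0: "q0 \<in> borel_measurable M"
    "\<And>t. t \<in> space M \<Longrightarrow> infdist (q0 t) (G t) < \<sigma> 0 t"
    "\<And>t. t \<in> space M \<Longrightarrow> dist (q0 t) (p t) < infdist (p t) (G t) + \<sigma> 0 t"
    using approximate_projection_step[where \<rho>="\<sigma> 0", OF ne mG p \<sigma>] by blast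
  have "\<exists>g. \<forall>n. (g n \<in> borel_measurable M \<and> (\<forall>t\<in>space M. infdist (g n t) (G t) < \<sigma> n t) \<and>
       (n = 0 \<longrightarrow> g n = q0)) \<and>
     (\<forall>t\<in>space M. dist (g (Suc n) t) (g n t) < infdist (g n t) (G t) + \<sigma> (Suc n) t)"
  proof (rule dependent_nat_choice)
    fix f n assume f: "f \<in> borel_measurable M \<and> (\<forall>t\<in>space M. infdist (f t) (G t) < \<sigma> n t) \<and>
       (n = 0 \<longrightarrow> f = q0)"
    obtain h where "h \<in> borel_measurable M"
      "\<And>t. t \<in> space M \<Longrightarrow> infdist (h t) (G t) < \<sigma> (Suc n) t"
      "\<And>t. t \<in> space M \<Longrightarrow> dist (h t) (f t) < infdist (f t) (G t) + \<sigma> (Suc n) t"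
      using approximate_projection_step[where \<rho>="\<sigma> (Suc n)", OF ne mG conjunct1[OF f] \<sigma>] by blast
    then show "\<exists>h. (h \<in> borel_measurable M \<and> (\<forall>t\<in>space M. infdist (h t) (G t) < \<sigma> (Suc n) t) \<and>
       (Suc n = 0 \<longrightarrow> h = q0)) \<and> (\<forall>t\<in>space M. dist (h t) (f t) < infdist (f t) (G t) + \<sigma> (Suc n) t)"
      by blast
  qed (use q0 in auto)
  then obtain g where g: "\<And>n. g n \<in> borel_measurable M"
    "\<And>n t. t \<in> space M \<Longrightarrow> infdist (g n t) (G t) < \<sigma> n t" "g 0 = q0"
    "\<And>n t. t \<in> space M \<Longrightarrow> dist (g (Suc n) t) (g n t) < infdist (g n t) (G t) + \<sigma> (Suc n) t"
    by blast
  have ex: "\<exists>L. (\<lambda>n. g n t) \<longlonglongrightarrow> L \<and> L \<in> G t \<and> dist L (p t) \<le> infdist (p t) (G t) + \<rho> t"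
    if t: "t \<in> space M" for t
  proof -
    have sm: "(\<lambda>n. 3 * \<rho> t / 8 * (1/2)^n) sums (3 * \<rho> t / 8 * 2)"
      by (intro sums_mult) (use geometric_sums[of "1/2::real"] in simp)
    have le: "norm (g (Suc n) t - g n t) \<le> 3 * \<rho> t / 8 * (1/2)^n" for n
      using g(4)[OF t, of n] g(2)[OF t, of n] by (simp add: dist_norm \<sigma>_def field_simps)
    have s: "summable (\<lambda>n. g (Suc n) t - g n t)"
      by (rule summable_comparison_test'[OF sums_summable[OF sm] le])
    have nle: "norm (\<Sum>n. g (Suc n) t - g n t) \<le> 3 * \<rho> t / 4"
      using norm_suminf_le[OF le sums_summable[OF sm]] sums_unique[OF sm] by simp
    define L where "L = (\<Sum>n. g (Suc n) t - g n t) + g 0 t"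
    have "(\<lambda>n. (\<Sum>i<n. g (Suc i) t - g i t) + g 0 t) \<longlonglongrightarrow> L"
      unfolding L_def by (intro tendsto_add summable_LIMSEQ[OF s] tendsto_const)
    then have L: "(\<lambda>n. g n t) \<longlonglongrightarrow> L"
      by (simp add: sum_lessThan_telescope[of "\<lambda>n. g n t"])
    have "(\<lambda>n. infdist (g n t) (G t)) \<longlonglongrightarrow> infdist L (G t)"
      by (intro tendsto_infdist L)
    moreover have "(\<lambda>n. \<sigma> n t) \<longlonglongrightarrow> 0"
      unfolding \<sigma>_def by (intro tendsto_mult_right_zero LIMSEQ_power_zero) simp
    ultimately have "infdist L (G t) \<le> 0"
      by (rule LIMSEQ_le) (use g(2)[OF t] in \<open>auto intro: less_imp_le\<close>)
    then have "L \<in> G t"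
      using G[OF t] in_closed_iff_infdist_zero[of "G t" L] infdist_nonneg[of L "G t"] by auto
    moreover have "dist L (p t) \<le> infdist (p t) (G t) + \<rho> t"
    proof -
      have "dist L (q0 t) \<le> 3 * \<rho> t / 4" using nle by (simp add: L_def g(3) dist_norm)
      moreover have "dist (q0 t) (p t) \<le> infdist (p t) (G t) + \<rho> t / 4"
        using q0(3)[OF t] by (simp add: \<sigma>_def)
      ultimately show ?thesis using dist_triangle[of L "p t" "q0 t"] by simp
    qed
    ultimately show ?thesis using L by blast
  qed
  then obtain q where q: "\<And>t. t \<in> space M \<Longrightarrow> (\<lambda>n. g n t) \<longlonglongrightarrow> q t \<and> q t \<in> G t \<and>
      dist (q t) (p t) \<le> infdist (p t) (G t) + \<rho> t"
    by metis
  have "q \<in> borel_measurable M"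
    by (rule borel_measurable_LIMSEQ_metric[where f=g, OF g(1)]) (use q in blast)
  with q show ?thesis by (intro that[of q]) auto
qed

section \<open>Lipschitz multifunctions\<close>

text \<open>If all increments of length \<kappa> starting in the segment were at most
  \<open>q * \<kappa>\<close>, then telescoping the multiples of \<kappa> up to the last one not
  exceeding \<eta>, and covering the remainder by the one-sided Lipschitz bound, would give
  \<open>h \<eta> - h 0 \<le> q * \<eta> + L * \<kappa>\<close>. This is impossible once
  \<open>L * \<kappa>\<close> is below the excess.\<close>

lemma increment_at_small_scale:
  fixes h :: "real \<Rightarrow> real"
  assumes gap: "h \<eta> - h 0 > q * \<eta>" and q: "q \<ge> 0" and \<eta>: "\<eta> > 0"
    and lip: "\<And>s. 0 \<le> s \<Longrightarrow> s \<le> \<eta> \<Longrightarrow> h \<eta> \<le> h s + L * (\<eta> - s)" and L: "L \<ge> 0"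
  obtains \<kappa>0 where "\<kappa>0 > 0"
    "\<And>\<kappa>. 0 < \<kappa> \<Longrightarrow> \<kappa> < \<kappa>0 \<Longrightarrow> \<exists>s\<in>{0..\<eta>}. h (s + \<kappa>) - h s > q * \<kappa>"
proof -
  \<comment> \<open>The excess divided by \<open>L + 1\<close>: adding \<open>1\<close> keeps the
    denominator positive when \<open>L\<close> is \<open>0\<close> and leaves a surplus of \<kappa>
    for the contradiction.\<close>
  define \<kappa>0 where "\<kappa>0 = (h \<eta> - h 0 - q * \<eta>) / (L + 1)"
  have pos: "\<kappa>0 > 0" using gap L by (simp add: \<kappa>0_def)
  moreover have "\<exists>s\<in>{0..\<eta>}. h (s + \<kappa>) - h s > q * \<kappa>" if \<kappa>: "0 < \<kappa>" "\<kappa> < \<kappa>0" for \<kappa>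
  proof (rule ccontr)
    assume "\<not> (\<exists>s\<in>{0..\<eta>}. h (s + \<kappa>) - h s > q * \<kappa>)"
    then have step: "h (s + \<kappa>) - h s \<le> q * \<kappa>" if "0 \<le> s" "s \<le> \<eta>" for s using that by force
    have tel: "h (real n * \<kappa>) - h 0 \<le> real n * q * \<kappa>" if "real n * \<kappa> \<le> \<eta>" for n
      using that
    proof (induction n)
      case (Suc n)
      have le: "real n * \<kappa> \<le> \<eta>" using Suc.prems \<kappa>(1) by (simp add: algebra_simps)
      have "h (real n * \<kappa> + \<kappa>) - h (real n * \<kappa>) \<le> q * \<kappa>" using step[OF _ le] \<kappa>(1) by simp
      with Suc.IH[OF le] show ?case by (simp add: algebra_simps)
    qed simp
    define N where "N = nat \<lfloor>\<eta> / \<kappa>\<rfloor>"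
    have "real N \<le> \<eta> / \<kappa>" "\<eta> / \<kappa> < real N + 1"
      using \<eta> \<kappa>(1) unfolding N_def by (auto simp: of_nat_nat)
    then have N: "real N * \<kappa> \<le> \<eta>" "\<eta> - real N * \<kappa> \<le> \<kappa>" using \<kappa>(1) by (auto simp: field_simps)
    have "h \<eta> \<le> h (real N * \<kappa>) + L * (\<eta> - real N * \<kappa>)" using lip[of "real N * \<kappa>"] N \<kappa>(1) by simp
    also have "\<dots> \<le> h 0 + real N * q * \<kappa> + L * \<kappa>"
      using tel[OF N(1)] mult_left_mono[OF N(2) L] by linarith
    also have "\<dots> \<le> h 0 + q * \<eta> + L * \<kappa>"
      using mult_left_mono[OF N(1) q] by (simp add: algebra_simps)
    finally have "h \<eta> - h 0 - q * \<eta> \<le> L * \<kappa>" by simp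
    moreover have "(L + 1) * \<kappa> < h \<eta> - h 0 - q * \<eta>" using \<kappa>(2) L by (simp add: \<kappa>0_def field_simps)
    ultimately show False using \<kappa>(1) by (simp add: algebra_simps)
  qed
  ultimately show ?thesis by (rule that)
qed

locale lipschitz_multifun = sigma_finite_measure M
  for M :: "'t measure" +
  fixes F :: "'t \<Rightarrow> 'y::{banach, second_countable_topology} \<Rightarrow>
              'z::{banach, second_countable_topology} set"
    and l :: "'t \<Rightarrow> real"
  assumes nonempty_closed: "\<And>t a. t \<in> space M \<Longrightarrow> F t a \<noteq> {} \<and> closed (F t a)"
    and measurable_F: "\<And>a. measurable_multifun M (\<lambda>t. F t a)"
    and integrable_l: "integrable M l"
    and lipschitz: "\<And>t a b. t \<in> space M \<Longrightarrow>
           F t a \<subseteq> {c + (l t * norm (a - b)) *\<^sub>R d | c d. c \<in> F t b \<and> d \<in> cball 0 1}"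
begin

section \<open>The distance to the values of the multifunction\<close>

definition gap :: "'t \<Rightarrow> 'y \<Rightarrow> 'z \<Rightarrow> real" where
  "gap t a b = infdist b (F t a)"

lemma gap_nonneg: "0 \<le> gap t a b"
  by (simp add: gap_def infdist_nonneg)

lemma gap_eq_0_iff: "t \<in> space M \<Longrightarrow> gap t a b = 0 \<longleftrightarrow> b \<in> F t a"
  using nonempty_closed[of t a] by (simp add: gap_def in_closed_iff_infdist_zero)

text \<open>Each point of \<open>F t a'\<close> has a point of \<open>F t a\<close> within
  \<open>\<bar>l t\<bar> * norm (a - a')\<close>; the triangle inequality and the infimum over
  \<open>F t a'\<close> do the rest. The absolute value accounts for a possible negative sign of
  \<open>l t\<close>, which the symmetric unit ball absorbs.\<close>

lemma gap_lipschitz: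
  assumes t: "t \<in> space M"
  shows "gap t a b \<le> gap t a' b' + norm (b - b') + \<bar>l t\<bar> * norm (a - a')"
proof -
  have "gap t a b - norm (b - b') - \<bar>l t\<bar> * norm (a - a') \<le> dist b' c" if c: "c \<in> F t a'" for c
  proof -
    obtain c' e where c': "c' \<in> F t a" "e \<in> cball 0 1" "c = c' + (l t * norm (a' - a)) *\<^sub>R e"
      using lipschitz[OF t, of a' a] c by blast
    have "dist c c' = (\<bar>l t\<bar> * norm (a' - a)) * norm e" by (simp add: c'(3) dist_norm abs_mult)
    also have "\<dots> \<le> (\<bar>l t\<bar> * norm (a' - a)) * 1"
      using c'(2) by (intro mult_left_mono) auto
    finally have "dist c c' \<le> \<bar>l t\<bar> * norm (a - a')" by (simp add: norm_minus_commute)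
    moreover have "gap t a b \<le> dist b c'" unfolding gap_def by (rule infdist_le[OF c'(1)])
    moreover have "dist b c' \<le> dist b b' + (dist b' c + dist c c')"
      by (metis dist_triangle add_left_mono order_trans)
    ultimately show ?thesis by (simp add: dist_norm)
  qed
  then have "gap t a b - norm (b - b') - \<bar>l t\<bar> * norm (a - a') \<le> gap t a' b'"
    using nonempty_closed[OF t, of a'] unfolding gap_def[of t a' b'] infdist_def
    by (auto intro: cINF_greatest)
  then show ?thesis by simp
qed

lemma gap_le:
  assumes "t \<in> space M" "b' \<in> F t a'"
  shows "gap t a b \<le> norm (b - b') + \<bar>l t\<bar> * norm (a - a')"
  using gap_lipschitz[OF assms(1), of a b a' b'] gap_eq_0_iff[OF assms(1), of a' b'] assms(2) by simp

text \<open>A direction \<open>(u', v')\<close> that lands on the graph controls the distance after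
  a step along any other direction. For base points on the graph, \<open>u' = v' = 0\<close> is such
  a direction and yields the dominating function \<open>norm v + \<bar>l\<bar> * norm u\<close> for
  the quotients.\<close>

lemma gap_step_le:
  assumes "t \<in> space M" "b + \<eta> *\<^sub>R v' \<in> F t (a + \<eta> *\<^sub>R u')" "\<eta> \<ge> 0"
  shows "gap t (a + \<eta> *\<^sub>R u) (b + \<eta> *\<^sub>R v) \<le> \<eta> * (norm (v' - v) + \<bar>l t\<bar> * norm (u' - u))"
proof -
  have "(b + \<eta> *\<^sub>R v) - (b + \<eta> *\<^sub>R v') = - (\<eta> *\<^sub>R (v' - v))"
    "(a + \<eta> *\<^sub>R u) - (a + \<eta> *\<^sub>R u') = - (\<eta> *\<^sub>R (u' - u))"
    by (simp_all add: algebra_simps)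
  then have "norm ((b + \<eta> *\<^sub>R v) - (b + \<eta> *\<^sub>R v')) = \<eta> * norm (v' - v)"
    "norm ((a + \<eta> *\<^sub>R u) - (a + \<eta> *\<^sub>R u')) = \<eta> * norm (u' - u)"
    using assms(3) by (simp_all only: norm_minus_cancel norm_scaleR abs_of_nonneg)
  with gap_le[OF assms(1,2), of "a + \<eta> *\<^sub>R u" "b + \<eta> *\<^sub>R v"]
  show ?thesis by (simp add: algebra_simps)
qed

lemma continuous_gap:
  assumes t: "t \<in> space M" shows "continuous_on UNIV (\<lambda>p. gap t (fst p) (snd p))"
proof (rule lipschitz_on_continuous_on)
  show "(1 + \<bar>l t\<bar>)-lipschitz_on UNIV (\<lambda>p. gap t (fst p) (snd p))"
  proof (rule lipschitz_onI)
    fix p q :: "'y \<times> 'z"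
    have *: "gap t (fst p) (snd p) - gap t (fst q) (snd q) \<le> (1 + \<bar>l t\<bar>) * dist p q" for p q
    proof -
      have "norm (snd p - snd q) + \<bar>l t\<bar> * norm (fst p - fst q) \<le> dist p q + \<bar>l t\<bar> * dist p q"
        using dist_fst_le[of p q] dist_snd_le[of p q]
        by (intro add_mono mult_left_mono) (auto simp: dist_norm)
      with gap_lipschitz[OF t, of "fst p" "snd p" "fst q" "snd q"] show ?thesis
        by (simp add: algebra_simps)
    qed
    show "dist (gap t (fst p) (snd p)) (gap t (fst q) (snd q)) \<le> (1 + \<bar>l t\<bar>) * dist p q"
      using *[of p q] *[of q p] by (simp add: dist_real_def dist_commute abs_le_iff)
  qed simp
qed

lemma continuous_on_gap:
  fixes f :: "'p::topological_space \<Rightarrow> 'y" and g :: "'p \<Rightarrow> 'z"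
  assumes "t \<in> space M" "continuous_on S f" "continuous_on S g"
  shows "continuous_on S (\<lambda>p. gap t (f p) (g p))"
proof -
  have "continuous_on S (\<lambda>p. (f p, g p))" using assms by (intro continuous_intros)
  from continuous_on_compose2[OF continuous_gap[OF assms(1)] this] show ?thesis by simp
qed

text \<open>At fixed arguments a strict sublevel set of the distance is the set of \<open>t\<close>
  for which \<open>F t c\<close> meets an open ball, which is measurable by hypothesis. Joint
  continuity of \<open>gap t\<close> then allows measurable arguments.\<close>

lemma measurable_gap [measurable (raw)]:
  assumes a: "a \<in> borel_measurable M" and b: "b \<in> borel_measurable M"
  shows "(\<lambda>t. gap t (a t) (b t)) \<in> borel_measurable M"
proof -
  have pt: "(\<lambda>t. gap t c e) \<in> borel_measurable M" for c e
    unfolding borel_measurable_iff_less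
  proof
    fix r
    have "{t \<in> space M. gap t c e < r} = {t \<in> space M. F t c \<inter> ball e r \<noteq> {}}"
    proof (intro Collect_cong conj_cong refl)
      fix t assume t: "t \<in> space M"
      show "gap t c e < r \<longleftrightarrow> F t c \<inter> ball e r \<noteq> {}"
      proof
        assume "gap t c e < r"
        then obtain z where "z \<in> F t c" "dist e z < r"
          unfolding gap_def using nonempty_closed[OF t] infdist_less_witness by metis
        then show "F t c \<inter> ball e r \<noteq> {}" by auto
      next
        assume "F t c \<inter> ball e r \<noteq> {}"
        then obtain z where "z \<in> F t c" "dist e z < r" by auto
        then show "gap t c e < r" unfolding gap_def using infdist_le[of z "F t c" e] by simp
      qed
    qed
    also have "\<dots> \<in> sets M"
      using measurable_F[of c] unfolding measurable_multifun_def by simp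
    finally show "{t \<in> space M. gap t c e < r} \<in> sets M" .
  qed
  have "(\<lambda>t. (a t, b t)) \<in> borel_measurable M" using a b by measurable
  from measurable_Caratheodory[OF pt continuous_gap this] show ?thesis by simp
qed

text \<open>The values \<open>F t (a t)\<close> have an argument that varies with \<open>t\<close>.
  Their measurability is available through \<open>measurable_gap\<close>, which is why the
  projection lemma is phrased with distances instead of hits of open sets.\<close>

lemma near_projection:
  assumes a: "a \<in> borel_measurable M" and b: "b \<in> borel_measurable M"
    and \<rho>: "\<rho> \<in> borel_measurable M" "\<And>t. t \<in> space M \<Longrightarrow> 0 < (\<rho> t :: real)"
  shows "\<exists>q \<in> borel_measurable M. \<forall>t \<in> space M. q t \<in> F t (a t) \<and>
    norm (q t - b t) \<le> gap t (a t) (b t) + \<rho> t"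
proof -
  have "(\<lambda>t. infdist z (F t (a t))) \<in> borel_measurable M" for z
    using measurable_gap[OF a, of "\<lambda>_. z"] by (simp add: gap_def)
  from measurable_near_projection[OF nonempty_closed this b \<rho>]
  show ?thesis unfolding gap_def dist_norm by metis
qed

section \<open>Tangency as smallness of distance quotients\<close>

text \<open>Forwards, a nearby admissible direction bounds the quotient through
  \<open>gap_step_le\<close>. Backwards, \<open>u\<close> is kept and \<open>v\<close> is corrected
  to the difference quotient \<open>(c - b) / \<eta>\<close> with \<open>c\<close> a nearly closest
  point.\<close>

lemma pointwise_tangent_iff:
  assumes t: "t \<in> space M"
  shows "(u, v) \<in> clarke_tangent_cone (sum_prod_sp type_sp type_sp) (gph (F t)) (x, y) \<longleftrightarrow>
   (\<forall>\<epsilon>>0. \<exists>\<delta>>0. \<exists>r>0. \<forall>a b. b \<in> F t a \<longrightarrow> norm (a - x) + norm (b - y) \<le> \<delta> \<longrightarrow>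
     (\<forall>\<eta>\<in>{0..r}. gap t (a + \<eta> *\<^sub>R u) (b + \<eta> *\<^sub>R v) \<le> \<eta> * \<epsilon>))"
  unfolding clarke_tangent_cone_gph_iff
proof (intro iffI allI impI, goal_cases)
  case (1 \<epsilon>)
  note \<epsilon> = 1(2)
  have *: "gap t (a + \<eta> *\<^sub>R u) (b + \<eta> *\<^sub>R v) \<le> \<eta> * \<epsilon>"
    if "\<eta> \<ge> 0" "norm (u' - u) + norm (v' - v) \<le> \<epsilon> / (1 + \<bar>l t\<bar>)" "b + \<eta> *\<^sub>R v' \<in> F t (a + \<eta> *\<^sub>R u')"
    for a b \<eta> u' v'
  proof -
    have "gap t (a + \<eta> *\<^sub>R u) (b + \<eta> *\<^sub>R v) \<le> \<eta> * (norm (v' - v) + \<bar>l t\<bar> * norm (u' - u))"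
      by (rule gap_step_le[OF t that(3,1)])
    also have "\<dots> \<le> \<eta> * ((1 + \<bar>l t\<bar>) * (norm (u' - u) + norm (v' - v)))"
      by (intro mult_left_mono that) (simp add: algebra_simps)
    also have "\<dots> \<le> \<eta> * \<epsilon>"
      using that by (intro mult_left_mono) (auto simp: field_simps)
    finally show ?thesis .
  qed
  \<comment> \<open>The divisor absorbs the Lipschitz factor with which an error in \<open>u\<close>
    enters the distance.\<close>
  have "\<epsilon> / (1 + \<bar>l t\<bar>) > 0" using \<epsilon> by (simp add: add_pos_nonneg)
  from 1(1)[THEN spec, THEN mp, OF this]
  obtain \<delta> r where \<delta>r: "\<delta> > 0" "r > 0" and
    H: "\<forall>a b. b \<in> F t a \<longrightarrow> norm (a - x) + norm (b - y) \<le> \<delta> \<longrightarrow> (\<forall>\<eta>\<in>{0..r}.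
      \<exists>u' v'. norm (u' - u) + norm (v' - v) \<le> \<epsilon> / (1 + \<bar>l t\<bar>) \<and> b + \<eta> *\<^sub>R v' \<in> F t (a + \<eta> *\<^sub>R u'))"
    by (elim exE conjE) (rule that)
  show ?case
  proof (rule exI[of _ \<delta>], rule conjI[OF \<delta>r(1)], rule exI[of _ r], rule conjI[OF \<delta>r(2)],
          intro allI impI ballI)
    fix a b \<eta>
    assume prem: "b \<in> F t a" "norm (a - x) + norm (b - y) \<le> \<delta>" "\<eta> \<in> {0..r}"
    obtain u' v' where "norm (u' - u) + norm (v' - v) \<le> \<epsilon> / (1 + \<bar>l t\<bar>)" "b + \<eta> *\<^sub>R v' \<in> F t (a + \<eta> *\<^sub>R u')"
      using H[rule_format, OF prem] by blast
    with * prem(3) show "gap t (a + \<eta> *\<^sub>R u) (b + \<eta> *\<^sub>R v) \<le> \<eta> * \<epsilon>" by simp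
  qed
next
  case (2 \<epsilon>)
  note \<epsilon> = 2(2)
  have *: "\<exists>u' v'. norm (u' - u) + norm (v' - v) \<le> \<epsilon> \<and> b + \<eta> *\<^sub>R v' \<in> F t (a + \<eta> *\<^sub>R u')"
    if b: "b \<in> F t a" and "\<eta> \<ge> 0" and le: "gap t (a + \<eta> *\<^sub>R u) (b + \<eta> *\<^sub>R v) \<le> \<eta> * (\<epsilon> / 2)" for a b \<eta>
  proof (cases "\<eta> = 0")
    case True
    then show ?thesis using b \<epsilon> by (intro exI[of _ u] exI[of _ v]) auto
  next
    case False
    then have \<eta>: "\<eta> > 0" using that by simp
    then have "gap t (a + \<eta> *\<^sub>R u) (b + \<eta> *\<^sub>R v) < \<eta> * \<epsilon>" using le mult_pos_pos[OF \<eta> \<epsilon>] by simp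
    then obtain c where c: "c \<in> F t (a + \<eta> *\<^sub>R u)" "dist (b + \<eta> *\<^sub>R v) c < \<eta> * \<epsilon>"
      unfolding gap_def using nonempty_closed[OF t] infdist_less_witness by metis
    define v' where "v' = (1/\<eta>) *\<^sub>R (c - b)"
    have cb: "c = b + \<eta> *\<^sub>R v'" using \<eta> by (simp add: v'_def)
    have "\<eta> * norm (v' - v) = norm (\<eta> *\<^sub>R (v' - v))" using \<eta> by simp
    also have "\<dots> = dist (b + \<eta> *\<^sub>R v) c" by (simp add: cb dist_norm norm_minus_commute scaleR_right_diff_distrib)
    finally have "\<eta> * norm (v' - v) < \<eta> * \<epsilon>" using c(2) by simp
    then have "norm (v' - v) \<le> \<epsilon>" using \<eta> by simp
    then show ?thesis using c(1) cb by (intro exI[of _ u] exI[of _ v']) auto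
  qed
  \<comment> \<open>A closest point need not exist, so half of \<epsilon> is kept as slack to make
    the distance strictly smaller than \<open>\<eta> * \<epsilon>\<close>.\<close>
  have "\<epsilon> / 2 > 0" using \<epsilon> by simp
  from 2(1)[THEN spec, THEN mp, OF this]
  obtain \<delta> r where \<delta>r: "\<delta> > 0" "r > 0" and
    H: "\<forall>a b. b \<in> F t a \<longrightarrow> norm (a - x) + norm (b - y) \<le> \<delta> \<longrightarrow> (\<forall>\<eta>\<in>{0..r}.
      gap t (a + \<eta> *\<^sub>R u) (b + \<eta> *\<^sub>R v) \<le> \<eta> * (\<epsilon> / 2))"
    by (elim exE conjE) (rule that)
  show ?case
  proof (rule exI[of _ \<delta>], rule conjI[OF \<delta>r(1)], rule exI[of _ r], rule conjI[OF \<delta>r(2)],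
          intro allI impI ballI)
    fix a b \<eta>
    assume prem: "b \<in> F t a" "norm (a - x) + norm (b - y) \<le> \<delta>" "\<eta> \<in> {0..r}"
    show "\<exists>u' v'. norm (u' - u) + norm (v' - v) \<le> \<epsilon> \<and> b + \<eta> *\<^sub>R v' \<in> F t (a + \<eta> *\<^sub>R u')"
      by (rule *[OF prem(1) _ H[rule_format, OF prem]]) (use prem(3) in simp)
  qed
qed

lemma integrable_l_norm:
  assumes u: "ess_bounded M u"
  shows "integrable M (\<lambda>t. \<bar>l t\<bar> * norm (u t))"
proof (rule Bochner_Integration.integrable_bound)
  note [measurable] = ess_bounded_measurable[OF u] borel_measurable_integrable[OF integrable_l]
  show "integrable M (\<lambda>t. \<bar>l t\<bar> * Linf_norm M u)" using integrable_l by simp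
  show "(\<lambda>t. \<bar>l t\<bar> * norm (u t)) \<in> borel_measurable M" by measurable
  show "AE t in M. norm (\<bar>l t\<bar> * norm (u t)) \<le> norm (\<bar>l t\<bar> * Linf_norm M u)"
    using Linf_norm_AE[OF u]
    by eventually_elim (auto simp: abs_mult intro!: mult_left_mono)
qed

text \<open>The base point lies on the graph almost everywhere, so the distance after the step is at
  most \<eta> times the integrable function \<open>norm v + \<bar>l\<bar> * norm u\<close>.\<close>

lemma integrable_gap_step:
  assumes a: "a \<in> borel_measurable M" and b: "b \<in> borel_measurable M"
    and ab: "AE t in M. b t \<in> F t (a t)" and u: "ess_bounded M u" and v: "integrable M v" and "\<eta> \<ge> 0"
  shows "integrable M (\<lambda>t. gap t (a t + \<eta> *\<^sub>R u t) (b t + \<eta> *\<^sub>R v t))"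
proof (rule Bochner_Integration.integrable_bound)
  note [measurable] = a b ess_bounded_measurable[OF u] borel_measurable_integrable[OF v]
  show "integrable M (\<lambda>t. \<eta> * (norm (v t) + \<bar>l t\<bar> * norm (u t)))"
    using v integrable_l_norm[OF u] by simp
  show "(\<lambda>t. gap t (a t + \<eta> *\<^sub>R u t) (b t + \<eta> *\<^sub>R v t)) \<in> borel_measurable M" by measurable
  show "AE t in M. norm (gap t (a t + \<eta> *\<^sub>R u t) (b t + \<eta> *\<^sub>R v t)) \<le> norm (\<eta> * (norm (v t) + \<bar>l t\<bar> * norm (u t)))"
    using ab AE_space
  proof eventually_elim
    case (elim t)
    then have "gap t (a t + \<eta> *\<^sub>R u t) (b t + \<eta> *\<^sub>R v t) \<le> \<eta> * (norm (v t) + \<bar>l t\<bar> * norm (u t))"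
      using gap_step_le[of t "b t" \<eta> 0 "a t" 0 "u t" "v t"] \<open>\<eta> \<ge> 0\<close> by simp
    then show ?case by (simp add: gap_nonneg)
  qed
qed

text \<open>The integrated form of \<open>pointwise_tangent_iff\<close>. An error of the direction
  enters as its \<open>L1\<close> part plus the integral of \<bar>l\<bar> times its essentially
  bounded part. Conversely a measurable near-projection corrects \<open>v\<close> alone, and the
  integral of the distance bounds the \<open>L1\<close> norm of the correction.\<close>

lemma Sel_tangent_iff:
  assumes u: "ess_bounded M u" and v: "integrable M v"
  shows "Sel_tangent M (\<lambda>t. gph (F t)) x y u v \<longleftrightarrow>
   (\<forall>\<epsilon>>0. \<exists>\<delta>>0. \<exists>r>0. \<forall>a b. ess_bounded M a \<longrightarrow> integrable M b \<longrightarrow>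
     (AE t in M. b t \<in> F t (a t)) \<longrightarrow>
     Linf_norm M (\<lambda>t. a t - x t) + L1_norm M (\<lambda>t. b t - y t) \<le> \<delta> \<longrightarrow>
     (\<forall>\<eta>\<in>{0..r}. (\<integral>t. gap t (a t + \<eta> *\<^sub>R u t) (b t + \<eta> *\<^sub>R v t) \<partial>M) \<le> \<eta> * \<epsilon>))"
    (is "_ \<longleftrightarrow> ?R")
proof -
  note [measurable] = ess_bounded_measurable[OF u] borel_measurable_integrable[OF v]
  have gph: "(a, b) \<in> gph (F t) \<longleftrightarrow> b \<in> F t a" for a b t by (simp add: gph_def)
  define \<Lambda> where "\<Lambda> = (\<integral>t. \<bar>l t\<bar> \<partial>M)"
  have \<Lambda>: "\<Lambda> \<ge> 0" by (simp add: \<Lambda>_def)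
  have fwd: "(\<integral>t. gap t (a t + \<eta> *\<^sub>R u t) (b t + \<eta> *\<^sub>R v t) \<partial>M) \<le> \<eta> * \<epsilon>"
    if a: "ess_bounded M a" and b: "integrable M b" and ab: "AE t in M. b t \<in> F t (a t)"
      and u': "ess_bounded M u'" and v': "integrable M v'"
      and le: "Linf_norm M (\<lambda>t. u' t - u t) + L1_norm M (\<lambda>t. v' t - v t) \<le> \<epsilon> / (1 + \<Lambda>)"
      and mem: "AE t in M. b t + \<eta> *\<^sub>R v' t \<in> F t (a t + \<eta> *\<^sub>R u' t)" and \<eta>: "\<eta> \<ge> 0" and \<epsilon>: "\<epsilon> > 0"
    for a b u' v' \<eta> \<epsilon>
  proof -
    note [measurable] = ess_bounded_measurable[OF a] borel_measurable_integrable[OF b]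
    define N where "N = Linf_norm M (\<lambda>t. u' t - u t)"
    have du: "ess_bounded M (\<lambda>t. u' t - u t)" by (rule ess_bounded_diff[OF u' u])
    have N: "N \<ge> 0" unfolding N_def by (rule Linf_norm_nonneg[OF du])
    have "(\<integral>t. gap t (a t + \<eta> *\<^sub>R u t) (b t + \<eta> *\<^sub>R v t) \<partial>M)
        \<le> (\<integral>t. \<eta> * (norm (v' t - v t) + \<bar>l t\<bar> * N) \<partial>M)"
    proof (rule integral_mono_AE)
      show "integrable M (\<lambda>t. gap t (a t + \<eta> *\<^sub>R u t) (b t + \<eta> *\<^sub>R v t))"
        by (rule integrable_gap_step[OF _ _ ab u v \<eta>]) measurable
      show "integrable M (\<lambda>t. \<eta> * (norm (v' t - v t) + \<bar>l t\<bar> * N))"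
        using v v' integrable_l by simp
      show "AE t in M. gap t (a t + \<eta> *\<^sub>R u t) (b t + \<eta> *\<^sub>R v t) \<le> \<eta> * (norm (v' t - v t) + \<bar>l t\<bar> * N)"
        using Linf_norm_AE[OF du] mem AE_space
      proof eventually_elim
        case (elim t)
        have "gap t (a t + \<eta> *\<^sub>R u t) (b t + \<eta> *\<^sub>R v t)
            \<le> \<eta> * (norm (v' t - v t) + \<bar>l t\<bar> * norm (u' t - u t))"
          by (rule gap_step_le[OF elim(3,2) \<eta>])
        also have "\<dots> \<le> \<eta> * (norm (v' t - v t) + \<bar>l t\<bar> * N)"
          using elim(1) \<eta> by (intro mult_left_mono add_left_mono) (auto simp: N_def)
        finally show ?case .
      qed
    qed
    also have "\<dots> = \<eta> * (L1_norm M (\<lambda>t. v' t - v t) + \<Lambda> * N)"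
      using v v' integrable_l by (simp add: L1_norm_def \<Lambda>_def)
    also have "\<dots> \<le> \<eta> * ((1 + \<Lambda>) * (N + L1_norm M (\<lambda>t. v' t - v t)))"
      using \<eta> \<Lambda> N L1_norm_nonneg[of M "\<lambda>t. v' t - v t"] by (intro mult_left_mono) (auto simp: algebra_simps)
    also have "\<dots> \<le> \<eta> * \<epsilon>"
      using le \<Lambda> \<eta> by (intro mult_left_mono) (auto simp: N_def field_simps)
    finally show ?thesis .
  qed
  have bwd: "\<exists>u' v'. ess_bounded M u' \<and> integrable M v' \<and>
        Linf_norm M (\<lambda>t. u' t - u t) + L1_norm M (\<lambda>t. v' t - v t) \<le> \<epsilon> \<and>
        (AE t in M. b t + \<eta> *\<^sub>R v' t \<in> F t (a t + \<eta> *\<^sub>R u' t))"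
    if a: "ess_bounded M a" and b: "integrable M b" and ab: "AE t in M. b t \<in> F t (a t)"
      and \<eta>: "\<eta> \<ge> 0" and \<epsilon>: "\<epsilon> > 0"
      and le: "(\<integral>t. gap t (a t + \<eta> *\<^sub>R u t) (b t + \<eta> *\<^sub>R v t) \<partial>M) \<le> \<eta> * (\<epsilon> / 2)"
    for a b \<eta> \<epsilon>
  proof (cases "\<eta> = 0")
    case True
    have "Linf_norm M (\<lambda>t. u t - u t) \<le> 0" by (rule Linf_norm_le) auto
    then show ?thesis using u v ab \<epsilon> True by (intro exI[of _ u] exI[of _ v]) (auto simp: L1_norm_def)
  next
    case False
    then have \<eta>: "\<eta> > 0" using \<eta> by simp
    note [measurable] = ess_bounded_measurable[OF a] borel_measurable_integrable[OF b]
    \<comment> \<open>The projection error must be positive everywhere and yet integrable. On a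
      space of infinite measure a constant would not do, so a positive integrable weight is
      used.\<close>
    obtain h :: "'t \<Rightarrow> real" where h[measurable]: "h \<in> borel_measurable M"
      and h: "\<And>t. h t > 0" "integrable M h"
      by (rule obtain_positive_integrable_function) (rule that)
    define H where "H = (\<integral>t. h t \<partial>M)"
    have H: "H \<ge> 0" unfolding H_def using h(1) by (intro integral_nonneg_AE) (auto intro: less_imp_le)
    \<comment> \<open>Scaled so that the total projection error, after division by \<eta>, is at
      most \<open>\<epsilon> / 2\<close>; the distance itself accounts for the other half.\<close>
    define c where "c = \<epsilon> / (2 * (1 + H))"
    have c: "c > 0" "c * H \<le> \<epsilon> / 2"
      using \<epsilon> H by (auto simp: c_def field_simps)
    let ?g = "\<lambda>t. gap t (a t + \<eta> *\<^sub>R u t) (b t + \<eta> *\<^sub>R v t)"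
    obtain q where q[measurable]: "q \<in> borel_measurable M"
      and qF: "\<And>t. t \<in> space M \<Longrightarrow> q t \<in> F t (a t + \<eta> *\<^sub>R u t)"
      and qn: "\<And>t. t \<in> space M \<Longrightarrow> norm (q t - (b t + \<eta> *\<^sub>R v t)) \<le> ?g t + \<eta> * c * h t"
    proof -
      have "\<exists>q \<in> borel_measurable M. \<forall>t \<in> space M. q t \<in> F t (a t + \<eta> *\<^sub>R u t) \<and>
        norm (q t - (b t + \<eta> *\<^sub>R v t)) \<le> ?g t + \<eta> * c * h t"
        by (rule near_projection) (use \<eta> c(1) h(1) in \<open>measurable, simp_all\<close>)
      then show ?thesis using that by blast
    qed
    define v' where "v' t = (1/\<eta>) *\<^sub>R (q t - b t)" for t
    have [measurable]: "v' \<in> borel_measurable M" unfolding v'_def[abs_def] by measurable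
    have bv': "b t + \<eta> *\<^sub>R v' t = q t" for t using \<eta> by (simp add: v'_def)
    have ig: "integrable M ?g"
      by (rule integrable_gap_step[OF _ _ ab u v]) (use \<eta> in auto)
    then have ib: "integrable M (\<lambda>t. ?g t / \<eta> + c * h t)" using h(2) by simp
    have nv: "norm (v' t - v t) \<le> ?g t / \<eta> + c * h t" if t: "t \<in> space M" for t
    proof -
      have "\<eta> * norm (v' t - v t) = norm (\<eta> *\<^sub>R (v' t - v t))" using \<eta> by simp
      also have "\<dots> = norm (q t - (b t + \<eta> *\<^sub>R v t))"
        by (simp add: bv'[symmetric] scaleR_right_diff_distrib)
      also have "\<dots> \<le> \<eta> * (?g t / \<eta> + c * h t)" using qn[OF t] \<eta> by (simp add: distrib_left mult.assoc)
      finally show ?thesis using \<eta> by simp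
    qed
    have idv: "integrable M (\<lambda>t. v' t - v t)"
      by (rule Bochner_Integration.integrable_bound[OF ib])
        (use nv in \<open>auto intro!: AE_I2 intro: order_trans[OF _ abs_ge_self]\<close>)
    then have iv': "integrable M v'" using Bochner_Integration.integrable_add[OF idv v] by simp
    have "L1_norm M (\<lambda>t. v' t - v t) \<le> (\<integral>t. ?g t / \<eta> + c * h t \<partial>M)"
      unfolding L1_norm_def using idv ib nv by (intro integral_mono) auto
    also have "\<dots> = (\<integral>t. ?g t \<partial>M) / \<eta> + c * H" using ig h(2) by (simp add: H_def)
    also have "\<dots> \<le> \<epsilon> / 2 + \<epsilon> / 2" using le \<eta> c(2) by (intro add_mono) (auto simp: field_simps)
    finally have "L1_norm M (\<lambda>t. v' t - v t) \<le> \<epsilon>" by simp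
    moreover have "Linf_norm M (\<lambda>t. u t - u t) \<le> 0" by (rule Linf_norm_le) auto
    moreover have "AE t in M. b t + \<eta> *\<^sub>R v' t \<in> F t (a t + \<eta> *\<^sub>R u t)"
      using qF by (auto simp: bv')
    ultimately show ?thesis using u iv' by (intro exI[of _ u] exI[of _ v']) auto
  qed
  show ?thesis
  proof
    assume L: "Sel_tangent M (\<lambda>t. gph (F t)) x y u v"
    show ?R
    proof (intro allI impI, goal_cases)
      case (1 \<epsilon>)
      then have "\<epsilon> / (1 + \<Lambda>) > 0" using \<Lambda> by simp
      from L[unfolded Sel_tangent_def gph, THEN spec, THEN mp, OF this]
      obtain \<delta> r where \<delta>r: "\<delta> > 0" "r > 0" and
        H: "\<forall>a b. ess_bounded M a \<longrightarrow> integrable M b \<longrightarrow> (AE t in M. b t \<in> F t (a t)) \<longrightarrow>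
          Linf_norm M (\<lambda>t. a t - x t) + L1_norm M (\<lambda>t. b t - y t) \<le> \<delta> \<longrightarrow> (\<forall>\<eta>\<in>{0..r}.
          \<exists>u' v'. ess_bounded M u' \<and> integrable M v' \<and>
          Linf_norm M (\<lambda>t. u' t - u t) + L1_norm M (\<lambda>t. v' t - v t) \<le> \<epsilon> / (1 + \<Lambda>) \<and>
          (AE t in M. b t + \<eta> *\<^sub>R v' t \<in> F t (a t + \<eta> *\<^sub>R u' t)))"
        by (elim exE conjE) (rule that)
      show ?case
      proof (rule exI[of _ \<delta>], rule conjI[OF \<delta>r(1)], rule exI[of _ r], rule conjI[OF \<delta>r(2)],
          intro allI impI ballI)
        fix a b \<eta>
        assume prem: "ess_bounded M a" "integrable M b" "AE t in M. b t \<in> F t (a t)"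
          "Linf_norm M (\<lambda>t. a t - x t) + L1_norm M (\<lambda>t. b t - y t) \<le> \<delta>" "\<eta> \<in> {0..r}"
        obtain u' v' where uv': "ess_bounded M u'" "integrable M v'"
          "Linf_norm M (\<lambda>t. u' t - u t) + L1_norm M (\<lambda>t. v' t - v t) \<le> \<epsilon> / (1 + \<Lambda>)"
          "AE t in M. b t + \<eta> *\<^sub>R v' t \<in> F t (a t + \<eta> *\<^sub>R u' t)"
          using H[rule_format, OF prem] by blast
        from fwd[OF prem(1-3) uv' _ 1] prem(5)
        show "(\<integral>t. gap t (a t + \<eta> *\<^sub>R u t) (b t + \<eta> *\<^sub>R v t) \<partial>M) \<le> \<eta> * \<epsilon>" by simp
      qed
    qed
  next
    assume R: ?R
    show "Sel_tangent M (\<lambda>t. gph (F t)) x y u v"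
      unfolding Sel_tangent_def gph
    proof (intro allI impI, goal_cases)
      case (1 \<epsilon>)
      then have "\<epsilon> / 2 > 0" by simp
      from R[THEN spec, THEN mp, OF this]
      obtain \<delta> r where \<delta>r: "\<delta> > 0" "r > 0" and
        H: "\<forall>a b. ess_bounded M a \<longrightarrow> integrable M b \<longrightarrow> (AE t in M. b t \<in> F t (a t)) \<longrightarrow>
          Linf_norm M (\<lambda>t. a t - x t) + L1_norm M (\<lambda>t. b t - y t) \<le> \<delta> \<longrightarrow> (\<forall>\<eta>\<in>{0..r}.
          (\<integral>t. gap t (a t + \<eta> *\<^sub>R u t) (b t + \<eta> *\<^sub>R v t) \<partial>M) \<le> \<eta> * (\<epsilon> / 2))"
        by (elim exE conjE) (rule that)
      show ?case
      proof (rule exI[of _ \<delta>], rule conjI[OF \<delta>r(1)], rule exI[of _ r], rule conjI[OF \<delta>r(2)],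
          intro allI impI ballI)
        fix a b \<eta>
        assume prem: "ess_bounded M a" "integrable M b" "AE t in M. b t \<in> F t (a t)"
          "Linf_norm M (\<lambda>t. a t - x t) + L1_norm M (\<lambda>t. b t - y t) \<le> \<delta>" "\<eta> \<in> {0..r}"
        show "\<exists>u' v'. ess_bounded M u' \<and> integrable M v' \<and>
          Linf_norm M (\<lambda>t. u' t - u t) + L1_norm M (\<lambda>t. v' t - v t) \<le> \<epsilon> \<and>
          (AE t in M. b t + \<eta> *\<^sub>R v' t \<in> F t (a t + \<eta> *\<^sub>R u' t))"
          by (rule bwd[OF prem(1-3) _ 1 H[rule_format, OF prem]]) (use prem(5) in simp)
      qed
    qed
  qed
qed

section \<open>From pointwise tangency to tangency of selections\<close>

text \<open>Failure for all \<delta> and \<open>r\<close> gives selections and step sizes with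
  quotients whose integrals stay above \<epsilon>. The first components converge uniformly off a
  null set, the second ones only in \<open>L1\<close>; along a subsequence both converge almost
  everywhere, and there pointwise tangency forces the quotients to \<open>0\<close>.\<close>

lemma Sel_tangent_if_pointwise:
  assumes x: "ess_bounded M x" and y: "integrable M y" and u: "ess_bounded M u" and v: "integrable M v"
    and tan: "AE t in M. (u t, v t) \<in>
      clarke_tangent_cone (sum_prod_sp type_sp type_sp) (gph (F t)) (x t, y t)"
  shows "Sel_tangent M (\<lambda>t. gph (F t)) x y u v"
proof (rule ccontr)
  define G where "G a b \<eta> = (\<integral>t. gap t (a t + \<eta> *\<^sub>R u t) (b t + \<eta> *\<^sub>R v t) \<partial>M)" for a b \<eta>
  assume "\<not> Sel_tangent M (\<lambda>t. gph (F t)) x y u v"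
  then obtain \<epsilon> where \<epsilon>: "\<epsilon> > 0" and
    neg: "\<not> (\<exists>\<delta>>0. \<exists>r>0. \<forall>a b. ess_bounded M a \<longrightarrow> integrable M b \<longrightarrow>
     (AE t in M. b t \<in> F t (a t)) \<longrightarrow>
     Linf_norm M (\<lambda>t. a t - x t) + L1_norm M (\<lambda>t. b t - y t) \<le> \<delta> \<longrightarrow>
     (\<forall>\<eta>\<in>{0..r}. G a b \<eta> \<le> \<eta> * \<epsilon>))"
    unfolding Sel_tangent_iff[OF u v] G_def[symmetric] not_all not_imp by (elim exE conjE) (rule that)
  have "\<exists>a b \<eta>. ess_bounded M a \<and> integrable M b \<and>
     (AE t in M. b t \<in> F t (a t)) \<and>
     Linf_norm M (\<lambda>t. a t - x t) + L1_norm M (\<lambda>t. b t - y t) \<le> \<delta> \<and> \<eta> \<in> {0..r} \<and> G a b \<eta> > \<eta> * \<epsilon>"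
    if \<delta>r: "\<delta> > 0" "r > 0" for \<delta> r
  proof (rule ccontr)
    assume no: "\<not> ?thesis"
    have "\<exists>\<delta>>0. \<exists>r>0. \<forall>a b. ess_bounded M a \<longrightarrow> integrable M b \<longrightarrow>
       (AE t in M. b t \<in> F t (a t)) \<longrightarrow>
       Linf_norm M (\<lambda>t. a t - x t) + L1_norm M (\<lambda>t. b t - y t) \<le> \<delta> \<longrightarrow>
       (\<forall>\<eta>\<in>{0..r}. G a b \<eta> \<le> \<eta> * \<epsilon>)"
    proof (rule exI[of _ \<delta>], rule conjI[OF \<delta>r(1)], rule exI[of _ r], rule conjI[OF \<delta>r(2)],
          intro allI impI ballI, rule ccontr)
      fix a b \<eta>
      assume "ess_bounded M a" "integrable M b" "AE t in M. b t \<in> F t (a t)"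
        "Linf_norm M (\<lambda>t. a t - x t) + L1_norm M (\<lambda>t. b t - y t) \<le> \<delta>" "\<eta> \<in> {0..r}"
        "\<not> G a b \<eta> \<le> \<eta> * \<epsilon>"
      then show False using no[unfolded not_ex, THEN spec[of _ a], THEN spec[of _ b], THEN spec[of _ \<eta>]]
        by (simp only: not_le simp_thms)
    qed
    with neg show False by contradiction
  qed
  then have "\<forall>n. \<exists>a b \<eta>. ess_bounded M a \<and> integrable M b \<and>
     (AE t in M. b t \<in> F t (a t)) \<and>
     Linf_norm M (\<lambda>t. a t - x t) + L1_norm M (\<lambda>t. b t - y t) \<le> 1 / Suc n \<and>
     \<eta> \<in> {0..1 / Suc n} \<and> G a b \<eta> > \<eta> * \<epsilon>" by simp
  then obtain a b \<eta> where *: "\<forall>n. ess_bounded M (a n) \<and> integrable M (b n) \<and>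
     (AE t in M. b n t \<in> F t (a n t)) \<and>
     Linf_norm M (\<lambda>t. a n t - x t) + L1_norm M (\<lambda>t. b n t - y t) \<le> 1 / Suc n \<and>
     \<eta> n \<in> {0..1 / Suc n} \<and> G (a n) (b n) (\<eta> n) > \<eta> n * \<epsilon>"
    unfolding choice_iff by (elim exE) (rule that)
  then have a: "\<And>n. ess_bounded M (a n)" and b: "\<And>n. integrable M (b n)"
    and ab: "\<And>n. AE t in M. b n t \<in> F t (a n t)"
    and near: "\<And>n. Linf_norm M (\<lambda>t. a n t - x t) + L1_norm M (\<lambda>t. b n t - y t) \<le> 1 / Suc n"
    and \<eta>: "\<And>n. 0 \<le> \<eta> n" "\<And>n. \<eta> n \<le> 1 / Suc n" and big: "\<And>n. G (a n) (b n) (\<eta> n) > \<eta> n * \<epsilon>"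
    by auto
  note [measurable] = ess_bounded_measurable[OF u] borel_measurable_integrable[OF v]
    ess_bounded_measurable[OF a] borel_measurable_integrable[OF b]
  \<comment> \<open>A step of size zero stays on the graph, so both sides of the strict inequality
    \<open>big\<close> would vanish. Positivity permits dividing by the step size.\<close>
  have \<eta>_pos: "\<eta> n > 0" for n
  proof (rule ccontr)
    assume "\<not> \<eta> n > 0"
    then have 0: "\<eta> n = 0" using \<eta>(1)[of n] by simp
    have "AE t in M. gap t (a n t) (b n t) = 0"
      using ab[of n] AE_space by eventually_elim (simp add: gap_eq_0_iff)
    then have "G (a n) (b n) (\<eta> n) = 0" unfolding G_def 0 by (simp add: integral_eq_zero_AE)
    then show False using big[of n] 0 by simp
  qed
  have anear: "AE t in M. \<forall>n. norm (a n t - x t) \<le> 1 / Suc n"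
    unfolding AE_all_countable
  proof
    fix n
    have "Linf_norm M (\<lambda>t. a n t - x t) \<le> 1 / Suc n"
      using near[of n] L1_norm_nonneg[of M "\<lambda>t. b n t - y t"] by simp
    with Linf_norm_AE[OF ess_bounded_diff[OF a[of n] x]] show "AE t in M. norm (a n t - x t) \<le> 1 / Suc n"
      by (auto elim: eventually_mono)
  qed
  have "(\<lambda>n. \<integral>t. norm (b n t - y t) \<partial>M) \<longlonglongrightarrow> 0"
  proof (rule tendsto_sandwich[OF _ _ tendsto_const LIMSEQ_Suc[OF lim_1_over_n]])
    have "(\<integral>t. norm (b n t - y t) \<partial>M) \<le> 1 / Suc n" for n
      using near[of n] Linf_norm_nonneg[OF ess_bounded_diff[OF a[of n] x]] by (simp add: L1_norm_def)
    then show "\<forall>\<^sub>F n in sequentially. (\<integral>t. norm (b n t - y t) \<partial>M) \<le> 1 / of_nat (Suc n)" by simp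
  qed simp
  then obtain \<rho> where \<rho>: "strict_mono \<rho>" and blim: "AE t in M. (\<lambda>n. b (\<rho> n) t - y t) \<longlonglongrightarrow> 0"
    using tendsto_L1_AE_subseq[of M "\<lambda>n t. b n t - y t"] b y by auto
  define h where "h n t = gap t (a n t + \<eta> n *\<^sub>R u t) (b n t + \<eta> n *\<^sub>R v t) / \<eta> n" for n t
  have [measurable]: "h n \<in> borel_measurable M" for n unfolding h_def[abs_def] by measurable
  \<comment> \<open>A strictly increasing \<rho> satisfies \<open>n \<le> \<rho> n\<close>, so the
    bounds known for the original indices pass to the subsequence.\<close>
  have inv: "1 / Suc (\<rho> n) \<le> 1 / Suc n" for n
    using seq_suble[OF \<rho>, of n] by (intro divide_left_mono) auto
  have "(\<lambda>n. \<integral>t. h (\<rho> n) t \<partial>M) \<longlonglongrightarrow> (\<integral>t. 0 \<partial>M)"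
  proof (rule integral_dominated_convergence)
    show "integrable M (\<lambda>t. norm (v t) + \<bar>l t\<bar> * norm (u t))" using v integrable_l_norm[OF u] by simp
    show "AE t in M. norm (h (\<rho> n) t) \<le> norm (v t) + \<bar>l t\<bar> * norm (u t)" for n
      using ab[of "\<rho> n"] AE_space
    proof eventually_elim
      case (elim t)
      then have "h (\<rho> n) t \<le> norm (v t) + \<bar>l t\<bar> * norm (u t)"
        using gap_step_le[of t "b (\<rho> n) t" "\<eta> (\<rho> n)" 0 "a (\<rho> n) t" 0 "u t" "v t"] \<eta>_pos[of "\<rho> n"]
        by (simp add: h_def pos_divide_le_eq mult.commute)
      then show ?case using \<eta>(1)[of "\<rho> n"] by (simp add: h_def gap_nonneg)
    qed
    have abAE: "AE t in M. \<forall>n. b n t \<in> F t (a n t)" unfolding AE_all_countable using ab by blast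
    show "AE t in M. (\<lambda>n. h (\<rho> n) t) \<longlonglongrightarrow> 0"
      using tan anear blim abAE AE_space
    proof eventually_elim
      case (elim t)
      show ?case
      proof (rule LIMSEQ_I)
        fix e :: real assume "e > 0"
        then have "e / 2 > 0" by simp
        from elim(1)[unfolded pointwise_tangent_iff[OF elim(5)], THEN spec, THEN mp, OF this]
        obtain \<delta> r where \<delta>r: "\<delta> > 0" "r > 0" and
          H: "\<forall>a b. b \<in> F t a \<longrightarrow> norm (a - x t) + norm (b - y t) \<le> \<delta> \<longrightarrow> (\<forall>\<eta>\<in>{0..r}.
            gap t (a + \<eta> *\<^sub>R u t) (b + \<eta> *\<^sub>R v t) \<le> \<eta> * (e / 2))"
          by (elim exE conjE) (rule that)
        have l0: "(\<lambda>n. 1 / real (Suc n)) \<longlonglongrightarrow> 0" by (rule LIMSEQ_Suc[OF lim_1_over_n])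
        have "(\<lambda>n. 1 / real (Suc n) + norm (b (\<rho> n) t - y t)) \<longlonglongrightarrow> 0 + norm (0 :: 'z)"
          by (intro tendsto_add l0 tendsto_norm elim(3))
        then have "\<forall>\<^sub>F n in sequentially. 1 / real (Suc n) + norm (b (\<rho> n) t - y t) < \<delta>"
          using \<delta>r(1) by (intro order_tendstoD(2)) auto
        moreover have "\<forall>\<^sub>F n in sequentially. 1 / real (Suc n) < r"
          using \<delta>r(2) by (intro order_tendstoD(2)[OF l0]) auto
        ultimately have "\<forall>\<^sub>F n in sequentially. norm (h (\<rho> n) t - 0) < e"
        proof eventually_elim
          case (elim n)
          have "\<eta> (\<rho> n) \<le> r" using \<eta>(2)[of "\<rho> n"] inv[of n] elim(2) by linarith
          then have "\<eta> (\<rho> n) \<in> {0..r}" using \<eta>(1)[of "\<rho> n"] by simp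
          moreover have "norm (a (\<rho> n) t - x t) \<le> 1 / Suc n"
            using spec[OF \<open>\<forall>n. norm (a n t - x t) \<le> 1 / Suc n\<close>, of "\<rho> n"] inv[of n] by linarith
          with elim(1) have "norm (a (\<rho> n) t - x t) + norm (b (\<rho> n) t - y t) \<le> \<delta>" by linarith
          ultimately have "gap t (a (\<rho> n) t + \<eta> (\<rho> n) *\<^sub>R u t) (b (\<rho> n) t + \<eta> (\<rho> n) *\<^sub>R v t) \<le> \<eta> (\<rho> n) * (e / 2)"
            using H \<open>\<forall>n. b n t \<in> F t (a n t)\<close> by (blast dest: spec)
          then have "h (\<rho> n) t \<le> e / 2"
            using \<eta>_pos[of "\<rho> n"] by (simp add: h_def pos_divide_le_eq mult.commute)
          moreover have "h (\<rho> n) t \<ge> 0" using \<eta>(1)[of "\<rho> n"] by (simp add: h_def gap_nonneg)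
          ultimately show ?case using \<open>e > 0\<close> by simp
        qed
        then show "\<exists>N. \<forall>n\<ge>N. norm (h (\<rho> n) t - 0) < e" by (simp add: eventually_sequentially)
      qed
    qed
  qed measurable
  then have "\<forall>\<^sub>F n in sequentially. (\<integral>t. h (\<rho> n) t \<partial>M) < \<epsilon>"
    using \<epsilon> by (intro order_tendstoD(2)) auto
  then obtain n where n: "(\<integral>t. h (\<rho> n) t \<partial>M) < \<epsilon>" by (auto simp: eventually_sequentially)
  have "(\<integral>t. h (\<rho> n) t \<partial>M) = G (a (\<rho> n)) (b (\<rho> n)) (\<eta> (\<rho> n)) / \<eta> (\<rho> n)"
    by (simp add: h_def G_def)
  then show False using n big[of "\<rho> n"] \<eta>_pos[of "\<rho> n"] by (simp add: pos_divide_less_eq mult.commute)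
qed

section \<open>From tangency of selections to pointwise tangency\<close>

text \<open>Along a fixed direction the increments of the distance function telescope, so a bad increment
  at one step size yields bad increments, at nearby base points off the graph, for all small step
  sizes. This uniformity is what allows one step size to serve all \<open>t\<close> simultaneously.\<close>

lemma increment_if_not_tangent:
  assumes t: "t \<in> space M"
    and nt: "(u, v) \<notin> clarke_tangent_cone (sum_prod_sp type_sp type_sp) (gph (F t)) (x, y)"
  shows "\<exists>j. \<forall>n. \<exists>m. \<forall>k\<ge>m. \<exists>p. norm (fst p) + norm (snd p) < 1 / Suc n \<and>
    gap t (x + fst p + (1 / Suc k) *\<^sub>R u) (y + snd p + (1 / Suc k) *\<^sub>R v) - gap t (x + fst p) (y + snd p)
      > 1 / Suc j * (1 / Suc k)"
proof -
  obtain \<epsilon> where \<epsilon>: "\<epsilon> > 0" and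
    neg: "\<not> (\<exists>\<delta>>0. \<exists>r>0. \<forall>a b. b \<in> F t a \<longrightarrow> norm (a - x) + norm (b - y) \<le> \<delta> \<longrightarrow>
       (\<forall>\<eta>\<in>{0..r}. gap t (a + \<eta> *\<^sub>R u) (b + \<eta> *\<^sub>R v) \<le> \<eta> * \<epsilon>))"
    using nt unfolding pointwise_tangent_iff[OF t] not_all not_imp by (elim exE conjE) (rule that)
  have H: "\<exists>a b \<eta>. b \<in> F t a \<and> norm (a - x) + norm (b - y) \<le> \<delta> \<and>
       \<eta> \<in> {0..r} \<and> gap t (a + \<eta> *\<^sub>R u) (b + \<eta> *\<^sub>R v) > \<eta> * \<epsilon>" if \<delta>r: "\<delta> > 0" "r > 0" for \<delta> r
  proof (rule ccontr)
    assume no: "\<not> ?thesis"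
    have "\<exists>\<delta>>0. \<exists>r>0. \<forall>a b. b \<in> F t a \<longrightarrow> norm (a - x) + norm (b - y) \<le> \<delta> \<longrightarrow>
       (\<forall>\<eta>\<in>{0..r}. gap t (a + \<eta> *\<^sub>R u) (b + \<eta> *\<^sub>R v) \<le> \<eta> * \<epsilon>)"
    proof (rule exI[of _ \<delta>], rule conjI[OF \<delta>r(1)], rule exI[of _ r], rule conjI[OF \<delta>r(2)],
          intro allI impI ballI, rule ccontr)
      fix a b \<eta>
      assume "b \<in> F t a" "norm (a - x) + norm (b - y) \<le> \<delta>" "\<eta> \<in> {0..r}"
        "\<not> gap t (a + \<eta> *\<^sub>R u) (b + \<eta> *\<^sub>R v) \<le> \<eta> * \<epsilon>"
      then show False using no[unfolded not_ex, THEN spec[of _ a], THEN spec[of _ b], THEN spec[of _ \<eta>]]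
        by (simp only: not_le simp_thms)
    qed
    with neg show False by contradiction
  qed
  \<comment> \<open>The rate \<epsilon> is replaced by one from a countable family, so that the
    exceptional points later form a countable union of sets.\<close>
  obtain j where j: "1 / real (Suc j) < \<epsilon>" using nat_approx_posE[OF \<epsilon>] by blast
  define w where "w = norm u + norm v"
  have w: "w \<ge> 0" by (simp add: w_def)
  show ?thesis
  proof (rule exI[of _ j], rule allI)
    fix n
    define \<delta> where "\<delta> = 1 / (2 * real (Suc n))"
    define r where "r = \<delta> / (1 + w)"
    have \<delta>: "\<delta> > 0" by (simp add: \<delta>_def)
    have r: "r > 0" "r * w < \<delta>" using \<delta> w by (auto simp: r_def field_simps)
    obtain a b \<eta> where ab: "b \<in> F t a" "norm (a - x) + norm (b - y) \<le> \<delta>" "0 \<le> \<eta>" "\<eta> \<le> r"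
      and big: "gap t (a + \<eta> *\<^sub>R u) (b + \<eta> *\<^sub>R v) > \<eta> * \<epsilon>"
      using H[OF \<delta> r(1)] by auto
    define h where "h s = gap t (a + s *\<^sub>R u) (b + s *\<^sub>R v)" for s
    have h0: "h 0 = 0" using ab(1) t by (simp add: h_def gap_eq_0_iff)
    then have \<eta>: "\<eta> > 0" using big ab(3) by (cases "\<eta> = 0") (auto simp: h_def)
    have "1 / real (Suc j) * \<eta> < h \<eta> - h 0"
      unfolding h0 using big mult_strict_right_mono[OF j \<eta>] by (simp add: h_def mult.commute)
    moreover have "h \<eta> \<le> h s + (norm v + \<bar>l t\<bar> * norm u) * (\<eta> - s)" if "0 \<le> s" "s \<le> \<eta>" for s
    proof -
      have "(b + \<eta> *\<^sub>R v) - (b + s *\<^sub>R v) = (\<eta> - s) *\<^sub>R v" "(a + \<eta> *\<^sub>R u) - (a + s *\<^sub>R u) = (\<eta> - s) *\<^sub>R u"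
        by (simp_all add: algebra_simps)
      then have norms: "norm ((b + \<eta> *\<^sub>R v) - (b + s *\<^sub>R v)) = (\<eta> - s) * norm v"
        "norm ((a + \<eta> *\<^sub>R u) - (a + s *\<^sub>R u)) = (\<eta> - s) * norm u"
        using that by simp_all
      show ?thesis
        using gap_lipschitz[OF t, of "a + \<eta> *\<^sub>R u" "b + \<eta> *\<^sub>R v" "a + s *\<^sub>R u" "b + s *\<^sub>R v"]
        unfolding norms h_def by (simp add: algebra_simps)
    qed
    ultimately obtain \<kappa>0 where \<kappa>0: "\<kappa>0 > 0"
      "\<And>\<kappa>. 0 < \<kappa> \<Longrightarrow> \<kappa> < \<kappa>0 \<Longrightarrow> \<exists>s\<in>{0..\<eta>}. h (s + \<kappa>) - h s > 1 / real (Suc j) * \<kappa>"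
      using increment_at_small_scale[of "1 / real (Suc j)" \<eta> h "norm v + \<bar>l t\<bar> * norm u"] \<eta> by auto
    obtain m where m: "1 / real (Suc m) < \<kappa>0" using nat_approx_posE[OF \<kappa>0(1)] by blast
    show "\<exists>m. \<forall>k\<ge>m. \<exists>p. norm (fst p) + norm (snd p) < 1 / Suc n \<and>
      gap t (x + fst p + (1 / Suc k) *\<^sub>R u) (y + snd p + (1 / Suc k) *\<^sub>R v) - gap t (x + fst p) (y + snd p)
      > 1 / Suc j * (1 / Suc k)"
    proof (intro exI[of _ m] allI impI)
      fix k assume k: "m \<le> k"
      define \<kappa> where "\<kappa> = 1 / real (Suc k)"
      have "\<kappa> \<le> 1 / real (Suc m)" using k by (simp add: \<kappa>_def frac_le)
      then obtain s where s: "0 \<le> s" "s \<le> \<eta>" "h (s + \<kappa>) - h s > 1 / real (Suc j) * \<kappa>"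
        using \<kappa>0(2)[of \<kappa>] m by (auto simp: \<kappa>_def)
      \<comment> \<open>The increment starts at the point reached after moving \<open>s\<close>
        along the direction, which need not lie on the graph; \<open>p\<close> is the shift from
        \<open>(x, y)\<close> to it.\<close>
      define p where "p = (a + s *\<^sub>R u - x, b + s *\<^sub>R v - y)"
      have "norm (fst p) \<le> norm (a - x) + s * norm u" "norm (snd p) \<le> norm (b - y) + s * norm v"
        using norm_triangle_ineq[of "a - x" "s *\<^sub>R u"] norm_triangle_ineq[of "b - y" "s *\<^sub>R v"] s(1)
        by (simp_all add: p_def algebra_simps)
      then have "norm (fst p) + norm (snd p) \<le> \<delta> + s * w" using ab(2) by (simp add: w_def algebra_simps)
      also have "\<dots> \<le> \<delta> + r * w" using s(2) ab(4) w by (intro add_left_mono mult_right_mono) auto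
      also have "\<dots> < 2 * \<delta>" using r(2) by simp
      also have "\<dots> = 1 / real (Suc n)" by (simp add: \<delta>_def field_simps)
      finally have "norm (fst p) + norm (snd p) < 1 / real (Suc n)" .
      moreover have eqs: "x + fst p = a + s *\<^sub>R u" "y + snd p = b + s *\<^sub>R v" by (simp_all add: p_def)
      have "gap t (x + fst p + \<kappa> *\<^sub>R u) (y + snd p + \<kappa> *\<^sub>R v) - gap t (x + fst p) (y + snd p)
          > 1 / real (Suc j) * \<kappa>"
        unfolding eqs using s(3) by (simp add: h_def scaleR_add_left add.assoc)
      ultimately show "\<exists>p. norm (fst p) + norm (snd p) < 1 / Suc n \<and>
        gap t (x + fst p + (1 / Suc k) *\<^sub>R u) (y + snd p + (1 / Suc k) *\<^sub>R v) - gap t (x + fst p) (y + snd p)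
        > 1 / Suc j * (1 / Suc k)"
        unfolding \<kappa>_def by blast
    qed
  qed
qed

text \<open>Points of non-tangency lie in countably many measurable sets \<open>B j\<close>, so it
  suffices that each is null. If one is not, a single step size serves a part \<open>S\<close> of
  positive finite measure. A selection that deviates from \<open>(x, y)\<close> on \<open>S\<close>
  only then violates the integral estimate.\<close>

lemma pointwise_if_Sel_tangent:
  assumes x: "ess_bounded M x" and y: "integrable M y" and xy: "AE t in M. y t \<in> F t (x t)"
    and u: "ess_bounded M u" and v: "integrable M v"
    and tan: "Sel_tangent M (\<lambda>t. gph (F t)) x y u v"
  shows "AE t in M. (u t, v t) \<in>
      clarke_tangent_cone (sum_prod_sp type_sp type_sp) (gph (F t)) (x t, y t)"
proof -
  note [measurable] = ess_bounded_measurable[OF x] borel_measurable_integrable[OF y]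
    ess_bounded_measurable[OF u] borel_measurable_integrable[OF v]
  obtain ds :: "nat \<Rightarrow> 'y \<times> 'z" where ds: "\<And>X. open X \<Longrightarrow> X \<noteq> {} \<Longrightarrow> \<exists>k. ds k \<in> X"
    using dense_sequence_exists by blast
  define inc where "inc t \<kappa> p =
    gap t (x t + fst p + \<kappa> *\<^sub>R u t) (y t + snd p + \<kappa> *\<^sub>R v t) - gap t (x t + fst p) (y t + snd p)" for t \<kappa> p
  define Q where "Q n j k t p \<longleftrightarrow> norm (fst p) + norm (snd p) < 1 / real (Suc n) \<and>
    inc t (1 / real (Suc k)) p > 1 / real (Suc j) * (1 / real (Suc k))" for n j k t p
  have inc_meas: "(\<lambda>t. inc t \<kappa> p) \<in> borel_measurable M" for \<kappa> p unfolding inc_def[abs_def] by measurable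
  have Q_meas[measurable]: "Measurable.pred M (\<lambda>t. Q n j k t p)" for n j k p
    using inc_meas[measurable] unfolding Q_def by measurable
  \<comment> \<open>Both conditions in \<open>Q\<close> are strict inequalities between continuous
    functions of the shift. They therefore survive at some member of the dense sequence, which
    reduces existence of a shift to a countable search.\<close>
  have Q_dense: "\<exists>i. Q n j k t (ds i)" if t: "t \<in> space M" and "Q n j k t p" for n j k t p
  proof -
    define X where "X = {p :: 'y \<times> 'z. norm (fst p) + norm (snd p) < 1 / real (Suc n)} \<inter>
      {p. 1 / real (Suc j) * (1 / real (Suc k)) < inc t (1 / real (Suc k)) p}"
    have "open X" unfolding X_def inc_def
      by (intro open_Int open_Collect_less continuous_intros continuous_on_gap[OF t])
    moreover have "p \<in> X" using that(2) by (simp add: X_def Q_def)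
    ultimately show ?thesis using ds[of X] by (auto simp: X_def Q_def)
  qed
  \<comment> \<open>Only quantifiers over natural numbers remain, hence measurability. The bound
    \<open>m\<close> depends on \<open>t\<close>, and this dependence is removed below by shrinking
    the set.\<close>
  define B where "B j = {t \<in> space M. \<forall>n. \<exists>m. \<forall>k\<ge>m. \<exists>i. Q n j k t (ds i)}" for j
  have B_meas: "B j \<in> sets M" for j unfolding B_def by measurable
  have B_null: "emeasure M (B j) = 0" for j
  proof (rule ccontr)
    assume nz: "emeasure M (B j) \<noteq> 0"
    obtain C :: "nat \<Rightarrow> 't set" where C: "range C \<subseteq> sets M" "(\<Union>i. C i) = space M" "\<And>i. emeasure M (C i) \<noteq> \<infinity>"
      using sigma_finite by blast
    have UC: "(\<Union>i. B j \<inter> C i) = B j" using C(2) sets.sets_into_space[OF B_meas[of j]] by blast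
    have "\<exists>i. emeasure M (B j \<inter> C i) \<noteq> 0"
    proof (rule ccontr)
      assume "\<not> ?thesis"
      then have "emeasure M (\<Union>i. B j \<inter> C i) = 0"
        using B_meas[of j] C(1) by (intro emeasure_UN_eq_0) auto
      then show False using nz unfolding UC by contradiction
    qed
    then obtain i where i: "emeasure M (B j \<inter> C i) \<noteq> 0" by blast
    \<comment> \<open>A piece of finite measure, so that constants supported on it are
      integrable.\<close>
    define A where "A = B j \<inter> C i"
    have Am[measurable]: "A \<in> sets M" unfolding A_def using B_meas[of j] C(1) by auto
    have "emeasure M A \<le> emeasure M (C i)" unfolding A_def using C(1) by (intro emeasure_mono) auto
    then have Afin: "emeasure M A \<noteq> \<infinity>" using C(3)[of i] by (auto simp: top_unique)
    define \<alpha> where "\<alpha> = measure M A"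
    have \<alpha>: "\<alpha> > 0"
      using i Afin unfolding \<alpha>_def A_def measure_def by (simp add: enn2real_positive_iff less_top zero_less_iff_neq_zero)
    define q where "q = 1 / real (Suc j)"
    have q: "0 < q" "q \<le> 1" by (auto simp: q_def)
    define \<Lambda> where "\<Lambda> = (\<integral>t. \<bar>l t\<bar> \<partial>M)"
    have \<Lambda>: "\<Lambda> \<ge> 0" by (simp add: \<Lambda>_def)
    \<comment> \<open>The construction below yields an integral exceeding
      \<open>\<rho> * (\<alpha> / 2) = \<kappa> * q * \<alpha> / 4\<close>, twice what this
      tolerance permits.\<close>
    have "q * \<alpha> / 8 > 0" using q \<alpha> by simp
    from tan[unfolded Sel_tangent_iff[OF u v], THEN spec, THEN mp, OF this]
    obtain \<delta> r where \<delta>r: "\<delta> > 0" "r > 0" and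
        H: "\<forall>a b. ess_bounded M a \<longrightarrow> integrable M b \<longrightarrow> (AE t in M. b t \<in> F t (a t)) \<longrightarrow>
          Linf_norm M (\<lambda>t. a t - x t) + L1_norm M (\<lambda>t. b t - y t) \<le> \<delta> \<longrightarrow> (\<forall>\<eta>\<in>{0..r}.
          (\<integral>t. gap t (a t + \<eta> *\<^sub>R u t) (b t + \<eta> *\<^sub>R v t) \<partial>M) \<le> \<eta> * (q * \<alpha> / 8))"
      by (elim exE conjE) (rule that)
    \<comment> \<open>With shifts and projection error at most \<open>c\<close>, the first component
      moves by at most \<open>c\<close> in essential supremum. On \<open>S\<close> the second moves
      by at most \<open>c * (3 + \<bar>l t\<bar>)\<close>: one \<open>c\<close> for the shift,
      \<open>c + c * \<bar>l t\<bar>\<close> for the distance to be projected, and one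
      \<open>c\<close> for the projection error. Integrating gives \<open>K * c\<close> in
      total.\<close>
    define K where "K = 1 + 3 * \<alpha> + \<Lambda>"
    have K: "K > 0" using \<alpha> \<Lambda> by (simp add: K_def)
    obtain n where n: "1 / real (Suc n) < \<delta> / K" using nat_approx_posE[of "\<delta> / K"] \<delta>r(1) K by auto
    define c where "c = 1 / real (Suc n)"
    have c: "c > 0" "K * c \<le> \<delta>" using n K by (auto simp: c_def field_simps)
    \<comment> \<open>The sets on which the threshold \<open>m\<close> works increase to
      \<open>A\<close>, so some threshold serves more than half of its measure.\<close>
    define A' where "A' m = {t \<in> A. \<forall>k\<ge>m. \<exists>i. Q n j k t (ds i)}" for m
    have A'm: "A' m \<in> sets M" for m
    proof -
      have "A' m = A \<inter> {t \<in> space M. \<forall>k\<ge>m. \<exists>i. Q n j k t (ds i)}"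
        unfolding A'_def using sets.sets_into_space[OF Am] by blast
      also have "\<dots> \<in> sets M" by measurable
      finally show ?thesis .
    qed
    have UA': "(\<Union>m. A' m) = A" unfolding A'_def A_def B_def by blast
    have "incseq A'" unfolding A'_def by (intro incseq_SucI) (auto dest: Suc_leD)
    then have "(\<lambda>m. measure M (A' m)) \<longlonglongrightarrow> measure M (\<Union>m. A' m)"
      using A'm Afin by (intro Lim_measure_incseq) (auto simp: UA')
    then have "\<forall>\<^sub>F m in sequentially. \<alpha> / 2 < measure M (A' m)"
      unfolding UA' using \<alpha> by (intro order_tendstoD(1)) (auto simp: \<alpha>_def)
    then obtain m where m: "\<alpha> / 2 < measure M (A' m)" by (auto simp: eventually_sequentially)
    obtain k0 where k0: "1 / real (Suc k0) < r" using nat_approx_posE[OF \<delta>r(2)] by blast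
    \<comment> \<open>Being at least \<open>m\<close> makes step \<kappa> bad throughout
      \<open>S\<close>, at least \<open>n\<close> gives \<kappa> \<le> c and thereby \<rho> \<le> c,
      and at least \<open>k0\<close> gives \<kappa> \<le> r so that \<open>H\<close>
      applies.\<close>
    define k where "k = max m (max n k0)"
    define \<kappa> where "\<kappa> = 1 / real (Suc k)"
    have "1 / real (Suc k) \<le> 1 / real (Suc k0)" "1 / real (Suc k) \<le> 1 / real (Suc n)"
      by (intro frac_le; simp add: k_def)+
    then have \<kappa>: "0 < \<kappa>" "\<kappa> \<le> r" "\<kappa> \<le> c" using k0 by (auto simp: \<kappa>_def c_def)
    define S where "S = A' m"
    have Sm[measurable]: "S \<in> sets M" and SA: "S \<subseteq> A" using A'm by (auto simp: S_def A'_def)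
    then have Ssp: "t \<in> space M" if "t \<in> S" for t using that sets.sets_into_space by blast
    \<comment> \<open>The first suitable shift of the dense sequence is a measurable function of
      \<open>t\<close>.\<close>
    define e where "e t = ds (LEAST i. Q n j k t (ds i))" for t
    have "(\<lambda>t. LEAST i. Q n j k t (ds i)) \<in> measurable M (count_space UNIV)" by measurable
    then have e_meas[measurable]: "e \<in> borel_measurable M" unfolding e_def[abs_def]
      by (rule measurable_compose) simp
    have "Q n j k t (e t)" if "t \<in> S" for t
    proof -
      have "\<exists>i. Q n j k t (ds i)" using that by (simp add: S_def A'_def k_def)
      then show ?thesis unfolding e_def by (rule LeastI_ex)
    qed
    then have e: "norm (fst (e t)) + norm (snd (e t)) \<le> c" "inc t \<kappa> (e t) > q * \<kappa>" if "t \<in> S" for t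
      using that by (auto simp: Q_def c_def q_def \<kappa>_def intro: less_imp_le)
    have fst_e: "norm (fst (e t)) \<le> c" and snd_e: "norm (snd (e t)) \<le> c" if "t \<in> S" for t
      using e(1)[OF that] norm_ge_zero[of "fst (e t)"] norm_ge_zero[of "snd (e t)"] by linarith+
    have [measurable]: "(\<lambda>t. fst (e t)) \<in> borel_measurable M" "(\<lambda>t. snd (e t)) \<in> borel_measurable M"
      by (intro measurable_compose[OF e_meas] borel_measurable_continuous_onI continuous_intros)+
    define a where "a t = (if t \<in> S then x t + fst (e t) else x t)" for t
    define p where "p t = (if t \<in> S then y t + snd (e t) else y t)" for t
    have am[measurable]: "a \<in> borel_measurable M" unfolding a_def[abs_def] by measurable
    have pm[measurable]: "p \<in> borel_measurable M" unfolding p_def[abs_def] by measurable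
    \<comment> \<open>Half of the guaranteed increment \<open>q * \<kappa>\<close> is spent on the
      projection error; the other half survives as a lower bound for the distance.\<close>
    define \<rho> where "\<rho> = q * \<kappa> / 2"
    have \<rho>: "0 < \<rho>" "\<rho> \<le> c"
      using q \<kappa> mult_mono[OF q(2) \<kappa>(3)] c(1) by (auto simp: \<rho>_def)
    obtain b0 where [measurable]: "b0 \<in> borel_measurable M"
      and b0: "\<And>t. t \<in> space M \<Longrightarrow> b0 t \<in> F t (a t)"
        "\<And>t. t \<in> space M \<Longrightarrow> norm (b0 t - p t) \<le> gap t (a t) (p t) + \<rho>"
      using near_projection[OF am pm, of "\<lambda>_. \<rho>"] \<rho>(1) by auto
    define b where "b t = (if t \<in> S then b0 t else y t)" for t
    have [measurable]: "b \<in> borel_measurable M" unfolding b_def[abs_def] by measurable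
    have da: "norm (a t - x t) \<le> c" for t using fst_e[of t] c(1) by (simp add: a_def)
    then have "ess_bounded M (\<lambda>t. a t - x t)" unfolding ess_bounded_iff by (intro conjI exI[of _ c]) auto
    from ess_bounded_lin[OF x this, of 1] have a: "ess_bounded M a" by simp
    have an: "Linf_norm M (\<lambda>t. a t - x t) \<le> c" using da c(1) by (intro Linf_norm_le) auto
    have ab: "AE t in M. b t \<in> F t (a t)"
      using xy AE_space
    proof eventually_elim
      case (elim t)
      then show ?case using b0(1)[of t] by (cases "t \<in> S") (simp_all add: a_def b_def)
    qed
    have db: "AE t in M. norm (b t - y t) \<le> c * (3 * indicator A t + \<bar>l t\<bar>)"
      using xy AE_space
    proof eventually_elim
      case (elim t)
      show ?case
      proof (cases "t \<in> S")
        case True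
        have "gap t (a t) (p t) \<le> norm (p t - y t) + \<bar>l t\<bar> * norm (a t - x t)"
          by (rule gap_le[OF elim(2,1)])
        also have "\<dots> \<le> c + \<bar>l t\<bar> * c"
          using True snd_e[OF True] da by (intro add_mono mult_left_mono) (auto simp: p_def)
        finally have "norm (b0 t - p t) \<le> c + \<bar>l t\<bar> * c + c" using b0(2)[OF elim(2)] \<rho>(2) by linarith
        moreover have "norm (p t - y t) \<le> c" using True snd_e[OF True] by (simp add: p_def)
        ultimately have "norm (b0 t - y t) \<le> 3 * c + \<bar>l t\<bar> * c"
          using norm_triangle_ineq[of "b0 t - p t" "p t - y t"] by simp
        then show ?thesis using True SA by (auto simp: b_def algebra_simps)
      next
        case False
        then show ?thesis using c(1) by (simp add: b_def)
      qed
    qed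
    have ibound: "integrable M (\<lambda>t. c * (3 * indicator A t + \<bar>l t\<bar>))"
      using integrable_l Afin by (auto intro!: integrable_real_indicator simp: less_top)
    have idb: "integrable M (\<lambda>t. b t - y t)"
      by (rule Bochner_Integration.integrable_bound[OF ibound])
        (use db in \<open>auto elim!: eventually_mono intro: order_trans[OF _ abs_ge_self]\<close>)
    then have b: "integrable M b" using Bochner_Integration.integrable_add[OF idb y] by simp
    have "L1_norm M (\<lambda>t. b t - y t) \<le> (\<integral>t. c * (3 * indicator A t + \<bar>l t\<bar>) \<partial>M)"
      unfolding L1_norm_def using idb ibound db by (intro integral_mono_AE) auto
    also have "\<dots> = c * (3 * \<alpha> + \<Lambda>)"
      using integrable_l Afin by (simp add: \<alpha>_def \<Lambda>_def less_top)
    finally have "Linf_norm M (\<lambda>t. a t - x t) + L1_norm M (\<lambda>t. b t - y t) \<le> K * c"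
      using an by (simp add: K_def algebra_simps)
    with c(2) have "Linf_norm M (\<lambda>t. a t - x t) + L1_norm M (\<lambda>t. b t - y t) \<le> \<delta>" by linarith
    from H[rule_format, OF a b ab this, of \<kappa>] \<kappa>
    have up: "(\<integral>t. gap t (a t + \<kappa> *\<^sub>R u t) (b t + \<kappa> *\<^sub>R v t) \<partial>M) \<le> \<kappa> * (q * \<alpha> / 8)" by simp
    \<comment> \<open>Replacing the shifted point \<open>p t\<close> by its near-projection
      \<open>b t\<close> changes the distance after the step by at most
      \<open>gap t (a t) (p t) + \<rho>\<close>. The first summand cancels the term subtracted in
      \<open>inc\<close>, so more than \<open>q * \<kappa> - \<rho> = \<rho>\<close> remains on
      \<open>S\<close>.\<close>
    have low: "\<rho> * indicator S t \<le> gap t (a t + \<kappa> *\<^sub>R u t) (b t + \<kappa> *\<^sub>R v t)" for t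
    proof (cases "t \<in> S")
      case True
      note t = Ssp[OF True]
      have "gap t (a t + \<kappa> *\<^sub>R u t) (p t + \<kappa> *\<^sub>R v t) \<le>
          gap t (a t + \<kappa> *\<^sub>R u t) (b t + \<kappa> *\<^sub>R v t) + norm (p t - b t)"
        using gap_lipschitz[OF t, of "a t + \<kappa> *\<^sub>R u t" "p t + \<kappa> *\<^sub>R v t" "a t + \<kappa> *\<^sub>R u t" "b t + \<kappa> *\<^sub>R v t"]
        by simp
      moreover have "norm (p t - b t) \<le> gap t (a t) (p t) + \<rho>"
        using b0(2)[OF t] True by (simp add: b_def norm_minus_commute)
      moreover have "gap t (a t + \<kappa> *\<^sub>R u t) (p t + \<kappa> *\<^sub>R v t) - gap t (a t) (p t) > q * \<kappa>"
        using e(2)[OF True] True by (simp add: inc_def a_def p_def)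
      ultimately show ?thesis using True by (simp add: \<rho>_def)
    qed (simp add: gap_nonneg)
    have Sfin: "emeasure M S < \<infinity>"
      using emeasure_mono[OF SA Am] Afin by (auto simp: less_top top_unique)
    have "\<rho> * measure M S = (\<integral>t. \<rho> * indicator S t \<partial>M)" using Sfin by simp
    also have "\<dots> \<le> (\<integral>t. gap t (a t + \<kappa> *\<^sub>R u t) (b t + \<kappa> *\<^sub>R v t) \<partial>M)"
      using low Sfin \<kappa>(1) by (intro integral_mono integrable_gap_step[OF _ _ ab u v]) auto
    finally have "\<rho> * measure M S \<le> \<kappa> * (q * \<alpha> / 8)" using up by linarith
    moreover have "\<rho> * (\<alpha> / 2) < \<rho> * measure M S" using m \<rho>(1) by (simp add: S_def)
    moreover have "\<kappa> * (q * \<alpha> / 8) \<le> \<rho> * (\<alpha> / 2)" using \<kappa> q \<alpha> by (simp add: \<rho>_def)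
    ultimately show False by linarith
  qed
  have "AE t in M. \<forall>j. t \<notin> B j"
    unfolding AE_all_countable
  proof
    fix j
    have "B j \<in> null_sets M" using B_null B_meas by (simp add: null_setsI)
    then show "AE t in M. t \<notin> B j" by (rule AE_not_in)
  qed
  then show ?thesis
    using AE_space
  proof eventually_elim
    case (elim t)
    show ?case
    proof (rule ccontr)
      assume nt: "\<not> ?thesis"
      obtain j where "\<forall>n. \<exists>m. \<forall>k\<ge>m. \<exists>p. Q n j k t p"
        using increment_if_not_tangent[OF elim(2) nt] unfolding Q_def inc_def by blast
      then have "t \<in> B j" unfolding B_def using Q_dense[OF elim(2)] elim(2) by blast
      with elim(1) show False by blast
    qed
  qed
qed

end

theorem corollary4p9:
  fixes M :: "'t measure"
    and F :: "'t \<Rightarrow> 'y::{banach, second_countable_topology} \<Rightarrow>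
              'z::{banach, second_countable_topology} set"
    and l :: "'t \<Rightarrow> real"
    and x :: "'t \<Rightarrow> 'y"
    and y :: "'t \<Rightarrow> 'z"
  assumes "complete_measure M"
    and "sigma_finite_measure M"
    and "\<And>t a. t \<in> space M \<Longrightarrow> F t a \<noteq> {} \<and> closed (F t a)"
    and "\<And>a. measurable_multifun M (\<lambda>t. F t a)"
    and "integrable M l"
    and "\<And>t a b. t \<in> space M \<Longrightarrow>
           F t a \<subseteq> {c + (l t * norm (a - b)) *\<^sub>R d | c d. c \<in> F t b \<and> d \<in> cball 0 1}"
    and "ess_bounded M x"
    and "integrable M y"
    and "AE t in M. y t \<in> F t (x t)"
  shows "clarke_tangent_cone (sum_prod_sp (Linf_sp M) (L1_sp M))
           (Sel_inf_1 M (\<lambda>t. gph (F t))) (ae_class M x, ae_class M y)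
         = Sel_inf_1 M
             (\<lambda>t. clarke_tangent_cone (sum_prod_sp type_sp type_sp) (gph (F t)) (x t, y t))"
proof -
  interpret lipschitz_multifun M F l
    unfolding lipschitz_multifun_def lipschitz_multifun_axioms_def using assms(2-6) by blast
  show ?thesis (is "?L = ?R")
  proof (intro equalityI subsetI)
    fix w assume w: "w \<in> ?L"
    then have "w \<in> vcarrier (sum_prod_sp (Linf_sp M) (L1_sp M))" by (simp add: clarke_tangent_cone_def)
    then obtain u v where uv: "w = (ae_class M u, ae_class M v)" "ess_bounded M u" "integrable M v"
      unfolding Linf_L1_sp_carrier by blast
    have "Sel_tangent M (\<lambda>t. gph (F t)) x y u v"
      using w clarke_tangent_cone_Sel_iff[OF assms(7,8) uv(2,3)] by (simp add: uv(1))
    from pointwise_if_Sel_tangent[OF assms(7-9) uv(2,3) this] uv show "w \<in> ?R"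
      unfolding Sel_inf_1_def by blast
  next
    fix w assume "w \<in> ?R"
    then obtain u v where uv: "w = (ae_class M u, ae_class M v)" "ess_bounded M u" "integrable M v"
      and tan: "AE t in M. (u t, v t) \<in>
        clarke_tangent_cone (sum_prod_sp type_sp type_sp) (gph (F t)) (x t, y t)"
      unfolding Sel_inf_1_def by blast
    from Sel_tangent_if_pointwise[OF assms(7,8) uv(2,3) tan] show "w \<in> ?L"
      using clarke_tangent_cone_Sel_iff[OF assms(7,8) uv(2,3)] by (simp add: uv(1))
  qed
qed

end
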